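(* Let $(S,N,Z)$ be a structured semigroup. Then the coset groupoid $\mathcal{C}(S)$ is an étale groupoid in its canonical topology.
   Context: A structured semigroup $(S,N,Z)$ consists of a semigroup $S$, a subsemigroup $N$ of $S$ and a subsemigroup $Z$ of $S$ with $Z\subseteq\mathsf{Z}(N)=\{z\in N:\forall n\in N\ (nz=zn)\}$, such that: (i) $Z$ is binormal: for all $a,b\in S$, $ab,ba\in Z$ implies $aZb\cup bZa\subseteq Z$; (ii) $N$ is $Z$-trinormal: for all $a,b\in S$ and $n\in N$, if $abn=n=nab$ and $ab,ba\in Z$ then $bna\in N$. For $a,s,b\in S$: $a<_sb$ means $asb=a=bsa$, $as,sa\in N$ and $bs,sb\in Z$; $a<b$ means $a<_sb$ for some $s\in S$. For $A,B\subseteq S$: $AB=\{ab:a\in A,b\in B\}$, $A^<=\{b\in S:\exists a\in A\ (a<b)\}$ and $A^*=\{s\in S:\exists a\in A\,\exists b\in S\ (a<_sb)\}$. A coset is a $C\subseteq S$ with $CC^*C\subseteq C=C^<$. $\mathcal{C}(S)$ is the set of non-empty cosets; with $\mathsf{s}(C)=(C^*C)^<$ and $\mathsf{r}(C)=(CC^* )^<$, it is a groupoid with inverse $C\mapsto C^*$ and product $B\cdot C=(BC)^<$ defined when $\mathsf{s}(B)=\mathsf{r}(C)$. The canonical topology on $\mathcal{C}(S)$ is the one generated by (i.e. with subbasis) the sets $\mathcal{C}_a=\{C\in\mathcal{C}(S):a\in C\}$, $a\in S$. A topological groupoid is a groupoid with a topology making the inverse and (partial) product continuous; it is étale if the source map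 sends open subsets of the groupoid to open subsets of the groupoid. No Hausdorff assumption is made. *)

theory Defs
  imports "HOL-Analysis.Analysis" "HOL-Library.Set_Algebras"
begin

text \<open>The semigroup \<open>S\<close> is the whole type \<open>'a\<close>, and \<open>A * B\<close> for sets is the elementwise product of
  \<^theory>\<open>HOL-Library.Set_Algebras\<close>. Subsemigroups are allowed to be empty.\<close>

definition subsemigroup :: "'a::semigroup_mult set \<Rightarrow> bool" where
  "subsemigroup A \<longleftrightarrow> (\<forall>a\<in>A. \<forall>b\<in>A. a * b \<in> A)"

definition center :: "'a::semigroup_mult set \<Rightarrow> 'a set" where
  "center N = {z \<in> N. \<forall>n\<in>N. n * z = z * n}"

definition binormal :: "'a::semigroup_mult set \<Rightarrow> bool" where
  "binormal Z \<longleftrightarrow>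
     (\<forall>a b. a * b \<in> Z \<and> b * a \<in> Z \<longrightarrow> (\<forall>z\<in>Z. a * z * b \<in> Z) \<and> (\<forall>z\<in>Z. b * z * a \<in> Z))"

definition trinormal :: "'a::semigroup_mult set \<Rightarrow> 'a set \<Rightarrow> bool" where
  "trinormal Z N \<longleftrightarrow>
     (\<forall>a b. \<forall>n\<in>N. a * b * n = n \<and> n = n * a * b \<and> a * b \<in> Z \<and> b * a \<in> Z \<longrightarrow> b * n * a \<in> N)"

definition structured_semigroup :: "'a::semigroup_mult set \<Rightarrow> 'a set \<Rightarrow> bool" where
  "structured_semigroup N Z \<longleftrightarrow>
     subsemigroup N \<and> subsemigroup Z \<and> Z \<subseteq> center N \<and> binormal Z \<and> trinormal Z N"

text \<open>\<open>dominated_via N Z a s b\<close> is $a <_s b$ and \<open>dominated N Z a b\<close> is $a < b$.\<close>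

definition dominated_via :: "'a::semigroup_mult set \<Rightarrow> 'a set \<Rightarrow> 'a \<Rightarrow> 'a \<Rightarrow> 'a \<Rightarrow> bool" where
  "dominated_via N Z a s b \<longleftrightarrow>
     a * s * b = a \<and> a = b * s * a \<and> a * s \<in> N \<and> s * a \<in> N \<and> b * s \<in> Z \<and> s * b \<in> Z"

definition dominated :: "'a::semigroup_mult set \<Rightarrow> 'a set \<Rightarrow> 'a \<Rightarrow> 'a \<Rightarrow> bool" where
  "dominated N Z a b \<longleftrightarrow> (\<exists>s. dominated_via N Z a s b)"

text \<open>\<open>up N Z A\<close> is $A^<$ and \<open>star N Z A\<close> is $A^*$.\<close>

definition up :: "'a::semigroup_mult set \<Rightarrow> 'a set \<Rightarrow> 'a set \<Rightarrow> 'a set" where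
  "up N Z A = {b. \<exists>a\<in>A. dominated N Z a b}"

definition star :: "'a::semigroup_mult set \<Rightarrow> 'a set \<Rightarrow> 'a set \<Rightarrow> 'a set" where
  "star N Z A = {s. \<exists>a\<in>A. \<exists>b. dominated_via N Z a s b}"

definition coset :: "'a::semigroup_mult set \<Rightarrow> 'a set \<Rightarrow> 'a set \<Rightarrow> bool" where
  "coset N Z C \<longleftrightarrow> C * star N Z C * C \<subseteq> C \<and> C = up N Z C"

definition cosets :: "'a::semigroup_mult set \<Rightarrow> 'a set \<Rightarrow> 'a set set" where
  "cosets N Z = {C. coset N Z C \<and> C \<noteq> {}}"

definition coset_source :: "'a::semigroup_mult set \<Rightarrow> 'a set \<Rightarrow> 'a set \<Rightarrow> 'a set" where
  "coset_source N Z C = up N Z (star N Z C * C)"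

definition coset_range :: "'a::semigroup_mult set \<Rightarrow> 'a set \<Rightarrow> 'a set \<Rightarrow> 'a set" where
  "coset_range N Z C = up N Z (C * star N Z C)"

definition coset_mult :: "'a::semigroup_mult set \<Rightarrow> 'a set \<Rightarrow> 'a set \<Rightarrow> 'a set \<Rightarrow> 'a set" where
  "coset_mult N Z B C = up N Z (B * C)"

definition canonical_topology :: "'a::semigroup_mult set \<Rightarrow> 'a set \<Rightarrow> 'a set topology" where
  "canonical_topology N Z = topology_generated_by (range (\<lambda>a. {C \<in> cosets N Z. a \<in> C}))"

text \<open>Groupoids are given by their arrows, units being identified with identity arrows. The product
  \<open>mult g h\<close> is only meaningful when \<open>src g = rng h\<close>.\<close>

locale groupoid =
  fixes G :: "'g set" and src rng invr :: "'g \<Rightarrow> 'g" and mult :: "'g \<Rightarrow> 'g \<Rightarrow> 'g"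
  assumes src_closed: "g \<in> G \<Longrightarrow> src g \<in> G"
    and rng_closed: "g \<in> G \<Longrightarrow> rng g \<in> G"
    and src_src: "g \<in> G \<Longrightarrow> src (src g) = src g"
    and rng_src: "g \<in> G \<Longrightarrow> rng (src g) = src g"
    and src_rng: "g \<in> G \<Longrightarrow> src (rng g) = rng g"
    and rng_rng: "g \<in> G \<Longrightarrow> rng (rng g) = rng g"
    and mult_closed: "\<lbrakk>g \<in> G; h \<in> G; src g = rng h\<rbrakk> \<Longrightarrow> mult g h \<in> G"
    and src_mult: "\<lbrakk>g \<in> G; h \<in> G; src g = rng h\<rbrakk> \<Longrightarrow> src (mult g h) = src h"
    and rng_mult: "\<lbrakk>g \<in> G; h \<in> G; src g = rng h\<rbrakk> \<Longrightarrow> rng (mult g h) = rng g"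
    and mult_assoc: "\<lbrakk>f \<in> G; g \<in> G; h \<in> G; src f = rng g; src g = rng h\<rbrakk>
          \<Longrightarrow> mult (mult f g) h = mult f (mult g h)"
    and mult_src: "g \<in> G \<Longrightarrow> mult g (src g) = g"
    and rng_mult_id: "g \<in> G \<Longrightarrow> mult (rng g) g = g"
    and inv_closed: "g \<in> G \<Longrightarrow> invr g \<in> G"
    and src_inv: "g \<in> G \<Longrightarrow> src (invr g) = rng g"
    and rng_inv: "g \<in> G \<Longrightarrow> rng (invr g) = src g"
    and inv_mult: "g \<in> G \<Longrightarrow> mult (invr g) g = src g"
    and mult_inv: "g \<in> G \<Longrightarrow> mult g (invr g) = rng g"

locale topological_groupoid = groupoid G src rng invr mult
  for G :: "'g set" and src rng invr :: "'g \<Rightarrow> 'g" and mult :: "'g \<Rightarrow> 'g \<Rightarrow> 'g" +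
  fixes T :: "'g topology"
  assumes topspace_eq: "topspace T = G"
    and continuous_inv: "continuous_map T T invr"
    and continuous_mult:
      "continuous_map (subtopology (prod_topology T T) {(g, h) \<in> G \<times> G. src g = rng h}) T
         (\<lambda>(g, h). mult g h)"

locale etale_groupoid = topological_groupoid G src rng invr mult T
  for G :: "'g set" and src rng invr :: "'g \<Rightarrow> 'g" and mult :: "'g \<Rightarrow> 'g \<Rightarrow> 'g"
    and T :: "'g topology" +
  assumes open_src: "open_map T T src"

end

theory Submission
  imports Defs
begin

text \<open>
  A picture to keep in mind: \<open>S\<close> consists of local sections of a groupoid, \<open>N\<close> of those supported on
  isotropy, \<open>Z\<close> of scalar functions on the unit space, and \<open>a <\<^sub>s b\<close> says that \<open>s\<close> inverts \<open>b\<close> on the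
  support of \<open>a\<close>. A coset is the collection of all sections through a given arrow, up to isotropy.
  A second example is a group \<open>S\<close> with \<open>Z = {1}\<close> and \<open>N\<close> a submonoid stable under conjugation: there \<open>a <\<^sub>s b\<close> means \<open>s = b\<^sup>-\<^sup>1\<close> and \<open>a b\<^sup>-\<^sup>1 \<in> N\<close>, so \<open>A\<^sup>< = N\<^sup>-\<^sup>1 A\<close> and
  \<open>A\<^sup>* = A\<^sup>-\<^sup>1 N\<close>. It shows where the asymmetry between \<open>N\<close> and \<open>N\<^sup>-\<^sup>1\<close> has to be overcome.

  The proof has three ideas.

  First, products of sections have to be shrunk before they are dominated. If \<open>a <\<^sub>s b\<close> and \<open>c <\<^sub>t d\<close>, then
  \<open>a c\<close> need not lie below \<open>b d\<close>, but \<open>a n c\<close> does for every \<open>n \<in> N\<close> that lives where both \<open>s b\<close> and \<open>d t\<close>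
  act as the identity (lemma \<open>dom_via_mult\<close>). Such \<open>n\<close> are always at hand as products of elements \<open>v a\<close>
  and \<open>c w\<close>, so all that remains is to see that the longer words stay in the sets considered.

  Second, the sets for which this works are pairs \<open>(P, Q)\<close> with \<open>P Q P \<subseteq> P\<close>, \<open>Q P Q \<subseteq> Q\<close>, \<open>P \<subseteq> Q\<^sup>*\<close>
  and \<open>Q \<subseteq> P\<^sup>*\<close> (\<open>inverse_pair\<close>). They include \<open>(C, C\<^sup>*)\<close> for every coset and are stable under composable
  products, and \<open>A\<^sup>< D\<^sup>< \<subseteq> (A D)\<^sup><\<close> holds for them (\<open>inverse_pair_up_mult\<close>). Hence upward closures
  may be taken once at the end of a computation, and each groupoid law becomes an identity between words in
  cosets and their stars. The one difficulty is that \<open>P\<^sup><\<close> is a coset with star \<open>Q\<^sup><\<close> only if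
  \<open>P\<^sup>* \<subseteq> Q\<^sup><\<close> (\<open>inverse_pair_saturate\<close>). This holds when some coset absorbs \<open>Q P\<close>, because a coset absorbs
  the isotropy by which \<open>P\<^sup>*\<close> and \<open>Q\<close> differ (\<open>star_subset_of_acting_coset\<close>).

  Third, whether \<open>s \<in> C\<^sup>*\<close> or \<open>x \<in> B \<cdot> C\<close> is witnessed by single elements of the cosets, which gives
  continuity at once. For the source map to be open, a coset \<open>D\<close> near the unit \<open>s(C)\<close> must be the source of a coset
  near \<open>C\<close>. A finite condition forces \<open>D\<close> to be a unit (\<open>coset_unitI\<close>), and with \<open>b \<in> C\<close> the translate
  \<open>(b D)\<^sup><\<close> is a coset with source \<open>D\<close> (\<open>unit_translate\<close>) that lies near \<open>C\<close>.
\<close>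

section \<open>The domination calculus\<close>

locale structured =
  fixes N Z :: "'a::semigroup_mult set"
  assumes structured: "structured_semigroup N Z"
begin

abbreviation dom_via :: "'a \<Rightarrow> 'a \<Rightarrow> 'a \<Rightarrow> bool" ("(_/ \<prec>\<^bsub>_\<^esub> _)" [51, 0, 51] 50)
  where "a \<prec>\<^bsub>s\<^esub> b \<equiv> dominated_via N Z a s b"

abbreviation Up :: "'a set \<Rightarrow> 'a set" ("(_\<^sup>\<up>)" [1000] 999)
  where "A\<^sup>\<up> \<equiv> up N Z A"

abbreviation Star :: "'a set \<Rightarrow> 'a set" ("(_\<^sup>\<star>)" [1000] 999)
  where "A\<^sup>\<star> \<equiv> star N Z A"

lemma N_mult: "m \<in> N \<Longrightarrow> n \<in> N \<Longrightarrow> m * n \<in> N"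
  using structured by (auto simp: structured_semigroup_def subsemigroup_def)

lemma Z_mult: "y \<in> Z \<Longrightarrow> z \<in> Z \<Longrightarrow> y * z \<in> Z"
  using structured by (auto simp: structured_semigroup_def subsemigroup_def)

lemma N_Z_commute: "n \<in> N \<Longrightarrow> z \<in> Z \<Longrightarrow> n * z = z * n"
  using structured by (auto simp: structured_semigroup_def center_def)

lemma Z_conj: "a * b \<in> Z \<Longrightarrow> b * a \<in> Z \<Longrightarrow> z \<in> Z \<Longrightarrow> a * z * b \<in> Z"
  using structured by (auto simp: structured_semigroup_def binormal_def)

lemma N_conj:
  assumes "n \<in> N" "a * b \<in> Z" "b * a \<in> Z" "(a * b) * n = n"
  shows "b * n * a \<in> N"
proof -
  have "n * a * b = n"
    using N_Z_commute[OF assms(1,2)] assms(4) by (simp add: mult.assoc)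
  then show ?thesis
    using structured assms unfolding structured_semigroup_def trinormal_def by metis
qed

text \<open>The last two equations let the simplifier use the first two inside right-associated words.\<close>

lemma dom_viaD:
  assumes "a \<prec>\<^bsub>s\<^esub> b"
  shows "a * (s * b) = a" "b * (s * a) = a" "a * s \<in> N" "s * a \<in> N" "b * s \<in> Z" "s * b \<in> Z"
    "a * (s * (b * x)) = a * x" "b * (s * (a * x)) = a * x"
  using assms unfolding dominated_via_def by (metis mult.assoc)+

lemma dom_viaI:
  assumes "a * (s * b) = a" "b * (s * a) = a" "a * s \<in> N" "s * a \<in> N" "b * s \<in> Z" "s * b \<in> Z"
  shows "a \<prec>\<^bsub>s\<^esub> b"
  using assms by (simp add: dominated_via_def mult.assoc)

lemma dom_via_trans:
  assumes ab: "a \<prec>\<^bsub>s\<^esub> b" and bc: "b \<prec>\<^bsub>t\<^esub> c"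
  shows "a \<prec>\<^bsub>t\<^esub> c"
proof (rule dom_viaI)
  have 1: "a * (s * (b * t)) = a * t" "t * (b * (s * a)) = t * a"
    by (simp_all add: dom_viaD[OF ab])
  show "a * (t * c) = a" "c * (t * a) = a"
    by (metis mult.assoc dom_viaD(1,2)[OF ab] dom_viaD(1,2)[OF bc])+
  show "a * t \<in> N"
    using N_mult[OF dom_viaD(3)[OF ab] dom_viaD(3)[OF bc]] 1 by (simp add: mult.assoc)
  show "t * a \<in> N"
    using N_mult[OF dom_viaD(4)[OF bc] dom_viaD(4)[OF ab]] 1 by (simp add: mult.assoc)
qed (use dom_viaD[OF bc] in auto)

lemma dom_via_flip:
  assumes "a \<prec>\<^bsub>s\<^esub> b"
  shows "s * a * s \<prec>\<^bsub>b\<^esub> s"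
  by (rule dom_viaI) (simp_all add: mult.assoc dom_viaD[OF assms])

text \<open>For \<open>a \<in> C\<close> this puts \<open>s b s\<close>, an element below \<open>s\<close>, into \<open>C\<^sup>\<star>\<close>. On the support of \<open>a\<close>, where \<open>r\<close> inverts \<open>b\<close>
  and \<open>s\<close> inverts \<open>c\<close>, the words \<open>s b s\<close> and \<open>c r c\<close> are mutually inverse: the reason is that one can commute
  the factor \<open>b r \<in> Z\<close> past \<open>a s \<in> N\<close>.\<close>

lemma dom_via_sandwich:
  assumes ab: "a \<prec>\<^bsub>r\<^esub> b" and bc: "b \<prec>\<^bsub>s\<^esub> c"
  shows "a \<prec>\<^bsub>s * b * s\<^esub> c * r * c"
proof -
  note [simp] = dom_viaD[OF ab] dom_viaD[OF bc] dom_viaD[OF dom_via_trans[OF ab bc]]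
  have c1: "(a * s) * (b * r) = (b * r) * (a * s)" and c2: "(s * a) * (r * b) = (r * b) * (s * a)"
    by (rule N_Z_commute; simp)+
  show ?thesis
  proof (rule dom_viaI)
    have "a * ((s * b * s) * (c * r * c)) = (a * s) * (b * r) * c"
      by (simp add: mult.assoc)
    then show "a * ((s * b * s) * (c * r * c)) = a"
      by (simp add: c1) (simp add: mult.assoc)
    have "(c * r * c) * ((s * b * s) * a) = c * ((r * b) * (s * a))"
      by (simp add: mult.assoc)
    then show "(c * r * c) * ((s * b * s) * a) = a"
      by (simp add: c2[symmetric]) (simp add: mult.assoc)
    have "(a * s) * (b * s) \<in> N" "(s * b) * (s * a) \<in> N"
      by (simp_all add: N_mult)
    then show "a * (s * b * s) \<in> N" "s * b * s * a \<in> N"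
      by (simp_all add: mult.assoc)
    have "c * (r * b) * s \<in> Z" "s * (b * r) * c \<in> Z"
      by (simp_all add: Z_conj)
    then show "c * r * c * (s * b * s) \<in> Z" "s * b * s * (c * r * c) \<in> Z"
      by (simp_all add: mult.assoc)
  qed
qed

text \<open>Replacing the partial inverse \<open>s\<close> by \<open>s t s\<close> changes it only by isotropy, because \<open>s t\<close> and \<open>t s\<close> lie
  in \<open>N\<close>; the correction of \<open>b\<close> to \<open>b u b\<close> undoes the change.\<close>

lemma dom_via_perturb_inverse:
  assumes ab: "a \<prec>\<^bsub>s\<^esub> b" and su: "s \<prec>\<^bsub>t\<^esub> u"
  shows "a \<prec>\<^bsub>s * t * s\<^esub> b * u * b"
proof -
  note [simp] = dom_viaD[OF ab] dom_viaD[OF su]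
  have c1: "(s * t) * (s * b) = (s * b) * (s * t)" and c2: "(t * s) * (b * s) = (b * s) * (t * s)"
    by (rule N_Z_commute; simp)+
  have w1: "s * t * s * b * u = s * b * s"
  proof -
    have "s * t * s * b * u = ((s * t) * (s * b)) * u" by (simp add: mult.assoc)
    also have "\<dots> = s * b * s" unfolding c1 by (simp add: mult.assoc)
    finally show ?thesis .
  qed
  have w2: "u * b * s * t * s = s * b * s"
  proof -
    have "u * b * s * t * s = u * ((b * s) * (t * s))" by (simp add: mult.assoc)
    also have "\<dots> = s * b * s" unfolding c2[symmetric] by (simp add: mult.assoc)
    finally show ?thesis .
  qed
  have w1': "(s * t * s) * (b * u * b) = (s * b) * (s * b)"
    using arg_cong[OF w1, of "\<lambda>x. x * b"] by (simp only: mult.assoc)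
  have w2': "(b * u * b) * (s * t * s) = (b * s) * (b * s)"
    using arg_cong[OF w2, of "\<lambda>x. b * x"] by (simp only: mult.assoc)
  show ?thesis
  proof (rule dom_viaI)
    show "a * ((s * t * s) * (b * u * b)) = a"
      by (simp only: w1') (simp add: mult.assoc)
    have "(b * u * b) * ((s * t * s) * a) = ((b * u * b) * (s * t * s)) * a"
      by (simp add: mult.assoc)
    then show "(b * u * b) * ((s * t * s) * a) = a"
      by (simp only: w2') (simp add: mult.assoc)
    have "(a * s) * (t * s) \<in> N" "(s * t) * (s * a) \<in> N"
      by (simp_all add: N_mult)
    then show "a * (s * t * s) \<in> N" "s * t * s * a \<in> N"
      by (simp_all add: mult.assoc)
    show "b * u * b * (s * t * s) \<in> Z" "s * t * s * (b * u * b) \<in> Z"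
      by (simp_all only: w1' w2') (simp_all add: Z_mult)
  qed
qed

text \<open>An inverse \<open>t\<close> of an inverse \<open>s\<close> of \<open>a\<close> extends \<open>a\<close> up to isotropy, and restricting \<open>t\<close> by \<open>a s\<close>
  or \<open>s a\<close> gives genuine lower bounds. Trinormality is what puts \<open>u (a s) t\<close> into \<open>N\<close>. The third part
  rewrites the lower bound as a word that a coset containing \<open>a\<close> and \<open>b\<close> visibly contains.\<close>

lemma dom_via_below_inverse_inverse:
  assumes ab: "a \<prec>\<^bsub>s\<^esub> b" and su: "s \<prec>\<^bsub>t\<^esub> u"
  shows "a * s * t \<prec>\<^bsub>u\<^esub> t" and "t * s * a \<prec>\<^bsub>u\<^esub> t"
    and "a * (s * t * s) * b = a * s * t"
proof -
  note [simp] = dom_viaD[OF ab] dom_viaD[OF su]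
  have c1: "(t * u) * (a * s) = a * s" 
    using N_Z_commute[of "a * s" "t * u"] by (simp add: mult.assoc)
  have c2: "(u * t) * (s * a) = s * a" 
    by (simp add: mult.assoc)
  have n1: "u * (a * s) * t \<in> N"
    by (rule N_conj[OF _ _ _ c1]) simp_all
  have n2: "t * (s * a) * u \<in> N"
    by (rule N_conj[OF _ _ _ c2]) simp_all
  show "a * s * t \<prec>\<^bsub>u\<^esub> t"
  proof (rule dom_viaI)
    show "a * s * t * (u * t) = a * s * t" by (simp add: mult.assoc)
    show "t * (u * (a * s * t)) = a * s * t"
      using arg_cong[OF c1, of "\<lambda>x. x * t"] by (simp add: mult.assoc)
  qed (use n1 in \<open>simp_all add: mult.assoc\<close>)
  have c3: "(s * a) * (u * t) = s * a"
    using N_Z_commute[of "s * a" "u * t"] by (simp add: mult.assoc)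
  show "t * s * a \<prec>\<^bsub>u\<^esub> t"
  proof (rule dom_viaI)
    show "t * (u * (t * s * a)) = t * s * a" by (simp add: mult.assoc)
    show "t * s * a * (u * t) = t * s * a"
      using arg_cong[OF c3, of "\<lambda>x. t * x"] by (simp add: mult.assoc)
  qed (use n2 in \<open>simp_all add: mult.assoc\<close>)
  have "a * (s * t * s) * b = a * ((s * t) * (s * b))" by (simp add: mult.assoc)
  also have "\<dots> = a * ((s * b) * (s * t))"
    by (subst N_Z_commute[of "s * t" "s * b"]) simp_all
  also have "\<dots> = a * s * t" by (simp add: mult.assoc)
  finally show "a * (s * t * s) * b = a * s * t" .
qed

text \<open>For \<open>m \<in> N\<close> alone, \<open>s m a\<close> need not be in \<open>N\<close>. The inserted \<open>a s\<close> makes \<open>m (a s)\<close> fixed by \<open>b s\<close>, so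
  that trinormality applies to it.\<close>

lemma dom_via_shrink_left:
  assumes ab: "a \<prec>\<^bsub>s\<^esub> b" and m: "m \<in> N"
  shows "m * (a * s * a) \<prec>\<^bsub>s\<^esub> b"
proof -
  note [simp] = dom_viaD[OF ab] m
  define n where "n = m * (a * s)"
  have n[simp]: "n \<in> N" by (simp add: n_def N_mult)
  have c: "(b * s) * n = n"
  proof -
    have "(b * s) * n = n * (b * s)" by (rule N_Z_commute[symmetric]) simp_all
    also have "\<dots> = m * ((a * s) * (b * s))" by (simp add: n_def mult.assoc)
    also have "\<dots> = n" by (simp add: n_def mult.assoc)
    finally show ?thesis .
  qed
  have "n * a \<prec>\<^bsub>s\<^esub> b"
  proof (rule dom_viaI)
    show "n * a * (s * b) = n * a" by (simp add: mult.assoc)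
    show "b * (s * (n * a)) = n * a"
      using arg_cong[OF c, of "\<lambda>x. x * a"] by (simp add: mult.assoc)
    show "n * a * s \<in> N" by (simp add: mult.assoc N_mult)
    \<comment> \<open>\<open>s n a = s n b s a\<close>, and \<open>s n b\<close> is a conjugate of \<open>n\<close>.\<close>
    have "(s * n * b) * (s * a) \<in> N"
      by (rule N_mult[OF N_conj[OF _ _ _ c]]) simp_all
    then show "s * (n * a) \<in> N" by (simp add: mult.assoc)
  qed simp_all
  then show ?thesis by (simp add: n_def mult.assoc)
qed

lemma dom_via_shrink_right:
  assumes ab: "a \<prec>\<^bsub>s\<^esub> b" and m: "m \<in> N"
  shows "(a * s * a) * m \<prec>\<^bsub>s\<^esub> b"
proof -
  note [simp] = dom_viaD[OF ab] m
  define n where "n = (s * a) * m"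
  have n[simp]: "n \<in> N" by (simp add: n_def N_mult)
  have c: "(s * b) * n = n" by (simp add: n_def mult.assoc)
  have c': "n * (s * b) = n" using c N_Z_commute[of n "s * b"] by simp
  have "a * n \<prec>\<^bsub>s\<^esub> b"
  proof (rule dom_viaI)
    show "a * n * (s * b) = a * n" by (simp add: mult.assoc c')
    show "b * (s * (a * n)) = a * n" by (simp add: mult.assoc)
    have "s * a * n \<in> N" by (simp add: N_mult)
    then show "s * (a * n) \<in> N" by (simp add: mult.assoc)
    have "(a * s) * (b * n * s) \<in> N"
      by (rule N_mult[OF _ N_conj[OF _ _ _ c]]) simp_all
    then show "a * n * s \<in> N" by (simp add: mult.assoc)
  qed simp_all
  then show ?thesis by (simp add: n_def mult.assoc)
qed

text \<open>The element \<open>n\<close> restricts to the place where \<open>a\<close> and \<open>c\<close> can be composed. It is needed because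
  \<open>a c t s\<close> is \<open>a s\<close> times the conjugate of \<open>c t\<close> by \<open>b\<close>, and trinormality puts such a conjugate into
  \<open>N\<close> only for elements fixed by \<open>s b\<close>.\<close>

lemma dom_via_mult:
  assumes ab: "a \<prec>\<^bsub>s\<^esub> b" and cd: "c \<prec>\<^bsub>t\<^esub> d"
    and n: "n \<in> N" "(s * b) * n = n" "(d * t) * n = n"
  shows "a * n * c \<prec>\<^bsub>t * s\<^esub> b * d"
proof -
  note [simp] = dom_viaD[OF ab] dom_viaD[OF cd] n(1)
  have e1: "n * (s * b) = n"
    using n N_Z_commute[of n "s * b"] by simp
  show ?thesis
  proof (rule dom_viaI)
    have "a * n * c * (t * s * (b * d)) = a * n * ((c * t) * (s * b)) * d"
      by (simp add: mult.assoc)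
    also have "\<dots> = a * (n * (s * b)) * (c * t) * d"
      by (subst N_Z_commute) (simp_all add: mult.assoc)
    also have "\<dots> = a * n * c"
      by (simp only: e1) (simp add: mult.assoc)
    finally show "a * n * c * (t * s * (b * d)) = a * n * c" .
    have "b * d * (t * s * (a * n * c)) = b * ((d * t) * (s * a)) * n * c"
      by (simp add: mult.assoc)
    also have "\<dots> = b * ((s * a) * (d * t)) * n * c"
      by (subst N_Z_commute[of "s * a" "d * t"]) simp_all
    also have "\<dots> = b * (s * a) * ((d * t) * n) * c"
      by (simp add: mult.assoc)
    also have "\<dots> = a * n * c"
      by (simp only: n) (simp add: mult.assoc)
    finally show "b * d * (t * s * (a * n * c)) = a * n * c" .
    have "(a * s) * (b * (n * (c * t)) * s) \<in> N"
    proof (rule N_mult[OF _ N_conj])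
      show "s * b * (n * (c * t)) = n * (c * t)" 
        using arg_cong[OF n(2), of "\<lambda>x. x * (c * t)"] by (simp add: mult.assoc)
    qed (simp_all add: N_mult)
    then show "a * n * c * (t * s) \<in> N" by (simp add: mult.assoc)
    have "(t * ((s * a) * n) * d) * (t * c) \<in> N"
    proof (rule N_mult[OF N_conj])
      have "(d * t) * ((s * a) * n) = ((s * a) * n) * (d * t)" 
        by (rule N_Z_commute[symmetric]) (simp_all add: N_mult)
      also have "\<dots> = (s * a) * ((d * t) * n)"
        by (simp only: mult.assoc[of "s * a"] N_Z_commute[OF n(1) dom_viaD(5)[OF cd]])
      finally show "(d * t) * ((s * a) * n) = (s * a) * n" by (simp only: n)
    qed (simp_all add: N_mult)
    then show "t * s * (a * n * c) \<in> N" by (simp add: mult.assoc)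
    have "b * (d * t) * s \<in> Z" "t * (s * b) * d \<in> Z"
      by (simp_all add: Z_conj)
    then show "b * d * (t * s) \<in> Z" "t * s * (b * d) \<in> Z"
      by (simp_all add: mult.assoc)
  qed
qed

text \<open>The form in which products get used: \<open>v\<close> and \<open>w\<close> are typically partial inverses of \<open>a\<close> and \<open>c\<close>, so
  the left-hand side stays in \<open>A V A \<cdot> C W C\<close> for the sets \<open>A, V, C, W\<close> the elements come from.\<close>

lemma dom_via_mult_shrunk:
  assumes ab: "a \<prec>\<^bsub>s\<^esub> b" and cd: "c \<prec>\<^bsub>t\<^esub> d" and v: "v * a \<in> N" and w: "c * w \<in> N"
  shows "(a * v * a) * (c * w * c) \<prec>\<^bsub>t * s\<^esub> b * d"
proof -
  note [simp] = dom_viaD[OF ab] dom_viaD[OF cd] v w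
  have "a * ((v * a) * (c * w)) * c \<prec>\<^bsub>t * s\<^esub> b * d"
  proof (rule dom_via_mult[OF ab cd])
    show "v * a * (c * w) \<in> N" by (simp add: N_mult)
    have "s * b * (v * a) = v * a"
      using N_Z_commute[OF v, of "s * b"] by (simp add: mult.assoc)
    from arg_cong[OF this, of "\<lambda>x. x * (c * w)"]
    show "s * b * (v * a * (c * w)) = v * a * (c * w)" by (simp add: mult.assoc)
    have "(d * t) * (v * a * (c * w)) = ((d * t) * (v * a)) * (c * w)"
      by (simp add: mult.assoc)
    also have "\<dots> = ((v * a) * (d * t)) * (c * w)" 
      using N_Z_commute[OF v, of "d * t"] by simp
    also have "\<dots> = v * a * (c * w)" by (simp add: mult.assoc)
    finally show "(d * t) * (v * a * (c * w)) = v * a * (c * w)" .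
  qed
  then show ?thesis by (simp add: mult.assoc)
qed

section \<open>Upward closure and star\<close>

lemma mem_up_iff: "b \<in> A\<^sup>\<up> \<longleftrightarrow> (\<exists>a\<in>A. \<exists>s. a \<prec>\<^bsub>s\<^esub> b)"
  by (auto simp: up_def dominated_def)

lemma mem_upI: "a \<in> A \<Longrightarrow> a \<prec>\<^bsub>s\<^esub> b \<Longrightarrow> b \<in> A\<^sup>\<up>"
  by (auto simp: mem_up_iff)

lemma mem_star_iff: "s \<in> A\<^sup>\<star> \<longleftrightarrow> (\<exists>a\<in>A. \<exists>b. a \<prec>\<^bsub>s\<^esub> b)"
  by (auto simp: star_def)

lemma mem_starI: "a \<in> A \<Longrightarrow> a \<prec>\<^bsub>s\<^esub> b \<Longrightarrow> s \<in> A\<^sup>\<star>"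
  by (auto simp: mem_star_iff)

lemma mem_upE: "b \<in> A\<^sup>\<up> \<Longrightarrow> (\<And>a s. a \<in> A \<Longrightarrow> a \<prec>\<^bsub>s\<^esub> b \<Longrightarrow> thesis) \<Longrightarrow> thesis"
  by (auto simp: mem_up_iff)

lemma mem_starE: "s \<in> A\<^sup>\<star> \<Longrightarrow> (\<And>a b. a \<in> A \<Longrightarrow> a \<prec>\<^bsub>s\<^esub> b \<Longrightarrow> thesis) \<Longrightarrow> thesis"
  by (auto simp: mem_star_iff)

lemma up_mono: "A \<subseteq> B \<Longrightarrow> A\<^sup>\<up> \<subseteq> B\<^sup>\<up>"
  by (meson mem_upE mem_upI subset_iff)

lemma star_mono: "A \<subseteq> B \<Longrightarrow> A\<^sup>\<star> \<subseteq> B\<^sup>\<star>"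
  by (meson mem_starE mem_starI subset_iff)

lemma up_up: "(A\<^sup>\<up>)\<^sup>\<up> \<subseteq> A\<^sup>\<up>"
  using dom_via_trans by (fastforce simp: mem_up_iff)

lemma star_up: "(A\<^sup>\<up>)\<^sup>\<star> \<subseteq> A\<^sup>\<star>"
  using dom_via_trans by (fastforce simp: mem_up_iff mem_star_iff)

lemma subset_star_star:
  assumes "C \<subseteq> C\<^sup>\<up>"
  shows "C \<subseteq> (C\<^sup>\<star>)\<^sup>\<star>"
proof
  fix c assume "c \<in> C"
  then obtain b s where b: "b \<in> C" "b \<prec>\<^bsub>s\<^esub> c"
    using assms by (meson mem_upE subset_iff)
  obtain a r where a: "a \<in> C" "a \<prec>\<^bsub>r\<^esub> b"
    using assms b(1) by (meson mem_upE subset_iff)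
  show "c \<in> (C\<^sup>\<star>)\<^sup>\<star>"
    by (rule mem_starI[OF mem_starI[OF a(1) dom_via_sandwich[OF a(2) b(2)]] dom_via_flip[OF b(2)]])
qed

lemma star_round:
  assumes "C = C\<^sup>\<up>"
  shows "C\<^sup>\<star> \<subseteq> (C\<^sup>\<star>)\<^sup>\<up>"
proof
  fix s assume "s \<in> C\<^sup>\<star>"
  then obtain a b where a: "a \<in> C" "a \<prec>\<^bsub>s\<^esub> b"
    by (auto simp: mem_star_iff)
  obtain a' r where a': "a' \<in> C" "a' \<prec>\<^bsub>r\<^esub> a"
    using assms a(1) by (metis mem_upE)
  show "s \<in> (C\<^sup>\<star>)\<^sup>\<up>"
    by (rule mem_upI[OF mem_starI[OF a'(1) dom_via_sandwich[OF a'(2) a(2)]] dom_via_flip[OF a(2)]])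
qed

lemma coset_up: "coset N Z C \<Longrightarrow> C\<^sup>\<up> = C"
  by (simp add: coset_def)

lemma coset_memI: "coset N Z C \<Longrightarrow> a \<in> C \<Longrightarrow> a \<prec>\<^bsub>s\<^esub> b \<Longrightarrow> b \<in> C"
  using coset_up mem_upI by blast

lemma coset_mult3: "coset N Z C \<Longrightarrow> a \<in> C \<Longrightarrow> s \<in> C\<^sup>\<star> \<Longrightarrow> b \<in> C \<Longrightarrow> a * s * b \<in> C"
  unfolding coset_def by (meson set_times_intro subsetD)

text \<open>If \<open>s \<in> C\<^sup>\<star>\<close> inverts \<open>a \<in> C\<close> and \<open>t\<close> inverts \<open>s\<close>, then \<open>s t s\<close> is again in \<open>C\<^sup>\<star>\<close>, so \<open>C\<close> contains
  \<open>a (s t s) b = a s t\<close>, which lies below \<open>t\<close>.\<close>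

lemma coset_star_star:
  assumes C: "coset N Z C"
  shows "(C\<^sup>\<star>)\<^sup>\<star> = C"
proof
  show "(C\<^sup>\<star>)\<^sup>\<star> \<subseteq> C"
  proof
    fix t assume "t \<in> (C\<^sup>\<star>)\<^sup>\<star>"
    then obtain s u where s: "s \<in> C\<^sup>\<star>" "s \<prec>\<^bsub>t\<^esub> u"
      by (auto simp: mem_star_iff)
    then obtain a b where a: "a \<in> C" "a \<prec>\<^bsub>s\<^esub> b"
      by (auto simp: mem_star_iff)
    have "a * (s * t * s) * b \<in> C"
      using coset_mult3[OF C] a coset_memI[OF C a] dom_via_perturb_inverse[OF a(2) s(2)] mem_starI
      by blast
    then show "t \<in> C"
      using dom_via_below_inverse_inverse[OF a(2) s(2)] coset_memI[OF C] by metis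
  qed
qed (simp add: subset_star_star coset_up[OF C])

lemma coset_star:
  assumes C: "coset N Z C"
  shows "coset N Z (C\<^sup>\<star>)"
  unfolding coset_def
proof
  have "C\<^sup>\<star> \<subseteq> (C\<^sup>\<star>)\<^sup>\<up>"
    using star_round coset_up[OF C] by simp
  moreover have "t \<in> C\<^sup>\<star>" if t: "t \<in> (C\<^sup>\<star>)\<^sup>\<up>" for t
  proof -
    obtain s u where s: "s \<in> C\<^sup>\<star>" "s \<prec>\<^bsub>u\<^esub> t"
      using t by (auto simp: mem_up_iff)
    obtain a b where a: "a \<in> C" "a \<prec>\<^bsub>s\<^esub> b"
      using s by (auto simp: mem_star_iff)
    have "u \<in> C"
      using s mem_starI coset_star_star[OF C] by blast
    have "a * (s * u * s) * b \<in> C"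
      using coset_mult3[OF C] a coset_memI[OF C a] dom_via_perturb_inverse[OF a(2) s(2)] mem_starI
      by blast
    then have "a * s * u \<in> C"
      using dom_via_below_inverse_inverse(3)[OF a(2) s(2)] by simp
    then show ?thesis
      using dom_via_below_inverse_inverse(1)[OF a(2) s(2)] mem_starI by blast
  qed
  ultimately show "C\<^sup>\<star> = (C\<^sup>\<star>)\<^sup>\<up>" by blast
  show "C\<^sup>\<star> * (C\<^sup>\<star>)\<^sup>\<star> * C\<^sup>\<star> \<subseteq> C\<^sup>\<star>"
    unfolding coset_star_star[OF C]
  proof (clarsimp elim!: set_times_elim)
    fix r c s assume rs: "r \<in> C\<^sup>\<star>" "c \<in> C" "s \<in> C\<^sup>\<star>"
    obtain a b where a: "a \<in> C" "a \<prec>\<^bsub>s\<^esub> b"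
      using rs by (auto simp: mem_star_iff)
    obtain a' b' where a': "a' \<in> C" "a' \<prec>\<^bsub>r\<^esub> b'"
      using rs by (auto simp: mem_star_iff)
    obtain y z where y: "y \<in> C\<^sup>\<star>" "y \<prec>\<^bsub>c\<^esub> z"
      using rs coset_star_star[OF C] by (metis mem_starE)
    note m = coset_mult3[OF C]
    \<comment> \<open>Two applications of the product lemma give a word below the product of the three upper bounds,
      with \<open>r c s\<close> as its inverse.\<close>
    let ?p = "(a * s * a) * (y * c * y)"
    have p: "?p \<prec>\<^bsub>c * s\<^esub> b * z"
      using dom_via_mult_shrunk[OF a(2) y(2), of s c] dom_viaD[OF a(2)] dom_viaD[OF y(2)] by simp
    have "(?p * (c * s) * ?p) * (a' * r * a') \<prec>\<^bsub>r * (c * s)\<^esub> (b * z) * b'"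
      using dom_via_mult_shrunk[OF p a'(2), of "c * s" r] dom_viaD[OF p] dom_viaD[OF a'(2)] by simp
    moreover have pc: "?p * x \<in> C" if "x \<in> C" for x
      using m[OF m[OF m[OF a(1) rs(3) a(1)] y(1) rs(2)] y(1) that] by (simp add: mult.assoc)
    have "?p * (c * s * (?p * (a' * r * a'))) \<in> C"
      by (intro pc m rs a')
    ultimately show "r * c * s \<in> C\<^sup>\<star>"
      by (metis mem_starI mult.assoc)
  qed
qed

section \<open>Inverse pairs\<close>

text \<open>Coset and star without upward closure: every element of \<open>P\<close> partially inverts one of \<open>Q\<close> and conversely.
  Unlike cosets, such pairs can be multiplied elementwise.\<close>

definition inverse_pair :: "'a set \<Rightarrow> 'a set \<Rightarrow> bool" where
  "inverse_pair P Q \<longleftrightarrow> P * Q * P \<subseteq> P \<and> Q * P * Q \<subseteq> Q \<and> P \<subseteq> Q\<^sup>\<star> \<and> Q \<subseteq> P\<^sup>\<star>"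

lemma inverse_pair_sym: "inverse_pair P Q \<Longrightarrow> inverse_pair Q P"
  by (auto simp: inverse_pair_def)

lemma inverse_pair_mult3: "inverse_pair P Q \<Longrightarrow> a \<in> P \<Longrightarrow> v \<in> Q \<Longrightarrow> b \<in> P \<Longrightarrow> a * v * b \<in> P"
  unfolding inverse_pair_def by (meson set_times_intro subsetD)

lemma inverse_pairE:
  assumes "inverse_pair P Q" "p \<in> P"
  obtains v y where "v \<in> Q" "v \<prec>\<^bsub>p\<^esub> y"
  using assms unfolding inverse_pair_def by (meson mem_starE subsetD)

lemma coset_inverse_pair:
  assumes "coset N Z C" shows "inverse_pair C (C\<^sup>\<star>)"
  using assms coset_star[OF assms] coset_star_star[OF assms] by (auto simp: inverse_pair_def coset_def)

text \<open>For \<open>v \<in> Q\<close> dominated via \<open>p\<close> and \<open>p' \<in> P\<close> dominated via \<open>v\<close>, the word \<open>p' v p \<in> P\<close> lies below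
  \<open>p\<close>.\<close>

lemma inverse_pair_up:
  assumes PQ: "inverse_pair P Q"
  shows "P \<subseteq> P\<^sup>\<up>"
proof
  fix p assume p: "p \<in> P"
  obtain v y where v: "v \<in> Q" "v \<prec>\<^bsub>p\<^esub> y"
    using inverse_pairE[OF PQ p] .
  obtain p' y' where p': "p' \<in> P" "p' \<prec>\<^bsub>v\<^esub> y'"
    using inverse_pairE[OF inverse_pair_sym[OF PQ] v(1)] .
  show "p \<in> P\<^sup>\<up>"
    by (rule mem_upI[OF inverse_pair_mult3[OF PQ p'(1) v(1) p]
          dom_via_below_inverse_inverse(1)[OF p'(2) v(2)]])
qed

text \<open>Partial inverses of the lower bounds \<open>a\<close> and \<open>d\<close> supply the elements of \<open>N\<close> that make \<open>a\<close> and \<open>d\<close>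
  multipliable, and the resulting words do not leave \<open>A\<close> and \<open>D\<close>.\<close>

lemma inverse_pair_up_mult:
  assumes A: "inverse_pair A A'" and D: "inverse_pair D D'"
  shows "A\<^sup>\<up> * D\<^sup>\<up> \<subseteq> (A * D)\<^sup>\<up>"
proof (clarify elim!: set_times_elim)
  fix x y assume "x \<in> A\<^sup>\<up>" "y \<in> D\<^sup>\<up>"
  then obtain a k d l where a: "a \<in> A" "a \<prec>\<^bsub>k\<^esub> x" and d: "d \<in> D" "d \<prec>\<^bsub>l\<^esub> y"
    by (metis mem_upE)
  obtain v e where v: "v \<in> A'" "v \<prec>\<^bsub>a\<^esub> e"
    using inverse_pairE[OF A a(1)] .
  obtain w f where w: "w \<in> D'" "w \<prec>\<^bsub>d\<^esub> f"
    using inverse_pairE[OF D d(1)] .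
  have "(a * v * a) * (d * w * d) \<prec>\<^bsub>l * k\<^esub> x * y"
    by (rule dom_via_mult_shrunk[OF a(2) d(2) dom_viaD(3)[OF v(2)] dom_viaD(4)[OF w(2)]])
  moreover have "(a * v * a) * (d * w * d) \<in> A * D"
    using inverse_pair_mult3[OF A] inverse_pair_mult3[OF D] a d v w by (intro set_times_intro) auto
  ultimately show "x * y \<in> (A * D)\<^sup>\<up>"
    by (rule mem_upI[rotated])
qed

lemma inverse_pair_up_up_mult:
  assumes A: "inverse_pair A A'" and D: "inverse_pair D D'"
  shows "(A\<^sup>\<up> * D\<^sup>\<up>)\<^sup>\<up> = (A * D)\<^sup>\<up>"
proof
  show "(A\<^sup>\<up> * D\<^sup>\<up>)\<^sup>\<up> \<subseteq> (A * D)\<^sup>\<up>"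
    using up_mono[OF inverse_pair_up_mult[OF A D]] up_up by blast
  show "(A * D)\<^sup>\<up> \<subseteq> (A\<^sup>\<up> * D\<^sup>\<up>)\<^sup>\<up>"
    by (intro up_mono set_times_mono2 inverse_pair_up[OF A] inverse_pair_up[OF D])
qed

lemma inverse_pair_mult:
  assumes P: "inverse_pair P P'" and R: "inverse_pair R R'"
    and 1: "P * R * R' \<subseteq> P" and 2: "P' * P * R \<subseteq> R"
  shows "inverse_pair (P * R) (R' * P')"
proof -
  have star: "A * B \<subseteq> (B' * A')\<^sup>\<star>" if A: "inverse_pair A A'" and B: "inverse_pair B B'" 
    for A A' B B'
  proof (clarify elim!: set_times_elim)
    fix a b assume ab: "a \<in> A" "b \<in> B"
    obtain v e where v: "v \<in> A'" "v \<prec>\<^bsub>a\<^esub> e"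
      using inverse_pairE[OF A ab(1)] .
    obtain w f where w: "w \<in> B'" "w \<prec>\<^bsub>b\<^esub> f"
      using inverse_pairE[OF B ab(2)] .
    have "(w * b * w) * (v * a * v) \<prec>\<^bsub>a * b\<^esub> f * e"
      by (rule dom_via_mult_shrunk[OF w(2) v(2) dom_viaD(4)[OF w(2)] dom_viaD(3)[OF v(2)]])
    moreover have "(w * b * w) * (v * a * v) \<in> B' * A'"
      using inverse_pair_mult3[OF inverse_pair_sym[OF A]] 
        inverse_pair_mult3[OF inverse_pair_sym[OF B]] ab v w
      by (intro set_times_intro) auto
    ultimately show "a * b \<in> (B' * A')\<^sup>\<star>"
      by (rule mem_starI[rotated])
  qed
  have "(P * R) * (R' * P') * (P * R) = (P * R * R') * (P' * P * R)"
    by (simp add: mult.assoc)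
  also have "\<dots> \<subseteq> P * R"
    by (intro set_times_mono2 1 2)
  finally have 3: "(P * R) * (R' * P') * (P * R) \<subseteq> P * R" .
  have "(R' * P') * (P * R) * (R' * P') = R' * (P' * (P * R * R') * P')"
    by (simp add: mult.assoc)
  also have "\<dots> \<subseteq> R' * (P' * P * P')"
    by (intro set_times_mono2 1 order_refl)
  also have "\<dots> \<subseteq> R' * P'"
    using P by (intro set_times_mono2 order_refl) (simp add: inverse_pair_def)
  finally show ?thesis
    using 3 star[OF P R] star[OF inverse_pair_sym[OF R] inverse_pair_sym[OF P]]
    by (simp add: inverse_pair_def)
qed

lemma inverse_pair_unit:
  assumes P: "inverse_pair P P'"
  shows "inverse_pair (P * P') (P * P')"
  using inverse_pair_mult[OF P inverse_pair_sym[OF P]] P by (simp add: inverse_pair_def)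

text \<open>The hypothesis on \<open>P\<^sup>\<star>\<close> cannot be dropped: in a group with \<open>Z = {1}\<close> and \<open>N\<close> not closed
  under inverses the pair \<open>({1}, {1})\<close> has upward
  closure \<open>N\<^sup>-\<^sup>1\<close> and star \<open>N\<close>. It suffices for one member of the pair, because the inclusion for the other follows by
  writing the lower bound \<open>p q h\<close> of \<open>h\<close> as \<open>p (q h q) y\<close> with \<open>q h q \<in> P\<^sup>\<star>\<close>.\<close>

lemma inverse_pair_saturate:
  assumes P: "inverse_pair P P'" and star: "P\<^sup>\<star> \<subseteq> P'\<^sup>\<up>"
  shows "coset N Z (P\<^sup>\<up>)" "(P\<^sup>\<up>)\<^sup>\<star> = P'\<^sup>\<up>"
proof -
  have "P\<^sup>\<up> * P'\<^sup>\<up> * P\<^sup>\<up> \<subseteq> (P * P')\<^sup>\<up> * P\<^sup>\<up>"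
    by (intro set_times_mono2 inverse_pair_up_mult[OF P inverse_pair_sym[OF P]] order_refl)
  also have "\<dots> \<subseteq> (P * P' * P)\<^sup>\<up>"
    by (rule inverse_pair_up_mult[OF inverse_pair_unit[OF P] P])
  also have "\<dots> \<subseteq> P\<^sup>\<up>"
    using P by (intro up_mono) (simp add: inverse_pair_def)
  finally have triple: "P\<^sup>\<up> * P'\<^sup>\<up> * P\<^sup>\<up> \<subseteq> P\<^sup>\<up>" .
  have star': "P'\<^sup>\<star> \<subseteq> P\<^sup>\<up>"
  proof
    fix h assume "h \<in> P'\<^sup>\<star>"
    then obtain q g where q: "q \<in> P'" "q \<prec>\<^bsub>h\<^esub> g"
      by (metis mem_starE)
    obtain p y where p: "p \<in> P" "p \<prec>\<^bsub>q\<^esub> y"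
      using inverse_pairE[OF inverse_pair_sym[OF P] q(1)] .
    have "q * h * q \<in> P'\<^sup>\<up>"
      using mem_starI[OF p(1) dom_via_perturb_inverse[OF p(2) q(2)]] star by blast
    then have "p * (q * h * q) * y \<in> P\<^sup>\<up>"
      using triple inverse_pair_up[OF P] p mem_upI by (meson set_times_intro subsetD)
    then show "h \<in> P\<^sup>\<up>"
      using dom_via_below_inverse_inverse[OF p(2) q(2)] mem_upI up_up by (metis subsetD)
  qed
  have ss: "(P\<^sup>\<up>)\<^sup>\<star> \<subseteq> P'\<^sup>\<up>"
    using star_up star by blast
  show "(P\<^sup>\<up>)\<^sup>\<star> = P'\<^sup>\<up>"
  proof
    have "P'\<^sup>\<up> \<subseteq> ((P'\<^sup>\<up>)\<^sup>\<star>)\<^sup>\<star>"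
      by (intro subset_star_star up_mono inverse_pair_up[OF inverse_pair_sym[OF P]])
    also have "\<dots> \<subseteq> (P\<^sup>\<up>)\<^sup>\<star>"
      by (rule star_mono) (use star_up star' in blast)
    finally show "P'\<^sup>\<up> \<subseteq> (P\<^sup>\<up>)\<^sup>\<star>" .
  qed (fact ss)
  then show "coset N Z (P\<^sup>\<up>)"
    using triple up_up up_mono[OF inverse_pair_up[OF P]] by (simp add: coset_def subset_antisym)
qed

text \<open>Here \<open>h\<close> inverts some \<open>p \<in> P\<close>, so \<open>h p \<in> N\<close>. The coset \<open>D\<close> absorbs it: \<open>d (h p)\<close>
  inverts an element of \<open>P' P D\<^sup>\<star> \<subseteq> D\<^sup>\<star>\<close> and so lies in \<open>D\<^sup>\<star>\<^sup>\<star> = D\<close>. Passing through the double star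
  is what replaces the missing inverses of elements of \<open>N\<close>. Then \<open>r (d (h p)) (v p v)\<close>, which is in \<open>P'\<close>, bounds
  \<open>h\<close> from below.\<close>

lemma star_subset_of_acting_coset:
  assumes D: "coset N Z D" "D \<noteq> {}" and P: "inverse_pair P P'"
    and 1: "P' * P * D\<^sup>\<star> \<subseteq> D\<^sup>\<star>" and 2: "D\<^sup>\<star> * D * P' \<subseteq> P'"
  shows "P\<^sup>\<star> \<subseteq> P'\<^sup>\<up>"
proof
  fix h assume "h \<in> P\<^sup>\<star>"
  then obtain p g where p: "p \<in> P" "p \<prec>\<^bsub>h\<^esub> g"
    by (metis mem_starE)
  obtain v q where v: "v \<in> P'" "v \<prec>\<^bsub>p\<^esub> q"
    using inverse_pairE[OF P p(1)] .
  obtain d where d: "d \<in> D" using D(2) by blast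
  obtain r e where r: "r \<in> D\<^sup>\<star>" "r \<prec>\<^bsub>d\<^esub> e"
    using inverse_pairE[OF coset_inverse_pair[OF D(1)] d] .
  note P'_mult3 = inverse_pair_mult3[OF inverse_pair_sym[OF P]]
  note star_mult3 = coset_mult3[OF coset_star[OF D(1)], unfolded coset_star_star[OF D(1)]]
  have act: "v * p * s \<in> D\<^sup>\<star>" if "s \<in> D\<^sup>\<star>" for s
    using 1 p(1) v(1) that by (meson set_times_intro subsetD)
  note [simp] = dom_viaD[OF p(2)] dom_viaD[OF v(2)] dom_viaD[OF r(2)]
  have dhp: "d * (h * p) \<in> D"
  proof -
    have m: "(v * p * v) * (p * v * p) \<prec>\<^bsub>h * p\<^esub> q * g"
      by (rule dom_via_mult_shrunk[OF v(2) p(2)]) simp_all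
    let ?m = "(v * p * v) * (p * v * p)"
    have "(v * p) * (v * p) * (v * p) \<in> N"
      by (simp only: N_mult dom_viaD(3)[OF v(2)])
    then have mN: "?m \<in> N"
      by (simp add: mult.assoc)
    have below: "(?m * ?m * ?m) * (r * d * r) \<prec>\<^bsub>d * (h * p)\<^esub> (q * g) * e"
      by (rule dom_via_mult_shrunk[OF m r(2)]) (simp_all add: mN N_mult)
    have "?m * s \<in> D\<^sup>\<star>" if "s \<in> D\<^sup>\<star>" for s
      using act[OF act[OF act[OF that]]] by (simp add: mult.assoc)
    then have "?m * (?m * (?m * (r * d * r))) \<in> D\<^sup>\<star>"
      using star_mult3[OF r(1) d r(1)] by blast
    then have "d * (h * p) \<in> (D\<^sup>\<star>)\<^sup>\<star>"
      using mem_starI[OF _ below] by (simp add: mult.assoc)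
    then show ?thesis
      by (simp add: coset_star_star[OF D(1)])
  qed
  let ?y = "h * p * v"
  have "(r * d) * (?y * g * ?y) \<prec>\<^bsub>g\<^esub> h"
    by (rule dom_via_shrink_left[OF dom_via_below_inverse_inverse(2)[OF v(2) p(2)]]) simp
  moreover have "(r * d) * (?y * g * ?y) = r * (d * (h * p)) * (v * p * v)"
    by (simp add: mult.assoc)
  moreover have "r * (d * (h * p)) * (v * p * v) \<in> P'"
    using 2 r(1) dhp P'_mult3[OF v(1) p(1) v(1)] by (meson set_times_intro subsetD)
  ultimately show "h \<in> P'\<^sup>\<up>"
    using mem_upI by metis
qed

section \<open>The coset groupoid\<close>

lemma cosetsD: "C \<in> cosets N Z \<Longrightarrow> coset N Z C" "C \<in> cosets N Z \<Longrightarrow> C \<noteq> {}"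
  by (simp_all add: cosets_def)

lemma star_nonempty: "coset N Z C \<Longrightarrow> C \<noteq> {} \<Longrightarrow> C\<^sup>\<star> \<noteq> {}"
  using coset_star_star[of C] by (force simp: mem_star_iff)

lemma star_in_cosets: "C \<in> cosets N Z \<Longrightarrow> C\<^sup>\<star> \<in> cosets N Z"
  using coset_star star_nonempty by (simp add: cosets_def)

lemma star_star: "C \<in> cosets N Z \<Longrightarrow> (C\<^sup>\<star>)\<^sup>\<star> = C"
  using coset_star_star cosetsD by blast

lemma cosets_inverse_pair: "C \<in> cosets N Z \<Longrightarrow> inverse_pair C (C\<^sup>\<star>)"
  using coset_inverse_pair cosetsD by blast

lemma cosets_up: "C \<in> cosets N Z \<Longrightarrow> C\<^sup>\<up> = C"
  using coset_up cosetsD by blast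

text \<open>The condition \<open>s(B) = r(C)\<close> in a form without upward closures.\<close>

definition composable :: "'a set \<Rightarrow> 'a set \<Rightarrow> bool" where
  "composable B C \<longleftrightarrow> B \<in> cosets N Z \<and> C \<in> cosets N Z \<and> B * C * C\<^sup>\<star> \<subseteq> B \<and> B\<^sup>\<star> * B * C \<subseteq> C"

lemma composable_inverse_pair: "composable B C \<Longrightarrow> inverse_pair (B * C) (C\<^sup>\<star> * B\<^sup>\<star>)"
  using cosets_inverse_pair by (intro inverse_pair_mult) (auto simp: composable_def)

lemma composable_star_right: "C \<in> cosets N Z \<Longrightarrow> composable C (C\<^sup>\<star>)"
  using inverse_pair_sym[OF cosets_inverse_pair] cosets_inverse_pair star_in_cosets star_star
  by (auto simp: composable_def inverse_pair_def)

lemma composable_star_left: "C \<in> cosets N Z \<Longrightarrow> composable (C\<^sup>\<star>) C"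
  using composable_star_right[OF star_in_cosets] star_star by metis

text \<open>The coset \<open>C\<close> itself absorbs \<open>C\<^sup>\<star> B\<^sup>\<star> B C\<close>, since \<open>B\<^sup>\<star> B C \<subseteq> C\<close>.\<close>

lemma composable_mult:
  assumes BC: "composable B C"
  shows "(B * C)\<^sup>\<up> \<in> cosets N Z" "((B * C)\<^sup>\<up>)\<^sup>\<star> = (C\<^sup>\<star> * B\<^sup>\<star>)\<^sup>\<up>"
proof -
  have B: "B \<in> cosets N Z" and C: "C \<in> cosets N Z" and 1: "B * C * C\<^sup>\<star> \<subseteq> B" and 2: "B\<^sup>\<star> * B * C \<subseteq> C"
    using BC by (auto simp: composable_def)
  note P = composable_inverse_pair[OF BC]
  have star: "(B * C)\<^sup>\<star> \<subseteq> (C\<^sup>\<star> * B\<^sup>\<star>)\<^sup>\<up>"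
  proof (rule star_subset_of_acting_coset[OF cosetsD[OF C] P])
    have "C\<^sup>\<star> * B\<^sup>\<star> * (B * C) * C\<^sup>\<star> = C\<^sup>\<star> * (B\<^sup>\<star> * B * C) * C\<^sup>\<star>"
      by (simp add: mult.assoc)
    also have "\<dots> \<subseteq> C\<^sup>\<star> * C * C\<^sup>\<star>"
      by (intro set_times_mono2 2 order_refl)
    also have "\<dots> \<subseteq> C\<^sup>\<star>"
      using cosets_inverse_pair[OF C] by (simp add: inverse_pair_def)
    finally show "C\<^sup>\<star> * B\<^sup>\<star> * (B * C) * C\<^sup>\<star> \<subseteq> C\<^sup>\<star>" .
    have "C\<^sup>\<star> * C * C\<^sup>\<star> \<subseteq> C\<^sup>\<star>"
      using cosets_inverse_pair[OF C] by (simp add: inverse_pair_def)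
    then have "(C\<^sup>\<star> * C * C\<^sup>\<star>) * B\<^sup>\<star> \<subseteq> C\<^sup>\<star> * B\<^sup>\<star>"
      by (intro set_times_mono2 order_refl)
    then show "C\<^sup>\<star> * C * (C\<^sup>\<star> * B\<^sup>\<star>) \<subseteq> C\<^sup>\<star> * B\<^sup>\<star>"
      by (simp add: mult.assoc)
  qed
  have "(B * C) \<noteq> {}"
    using cosetsD(2)[OF B] cosetsD(2)[OF C] by (auto simp: set_times_def)
  then show "(B * C)\<^sup>\<up> \<in> cosets N Z"
    using inverse_pair_saturate(1)[OF P star] inverse_pair_up[OF P] by (auto simp: cosets_def)
  show "((B * C)\<^sup>\<up>)\<^sup>\<star> = (C\<^sup>\<star> * B\<^sup>\<star>)\<^sup>\<up>"
    by (rule inverse_pair_saturate(2)[OF P star])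
qed

abbreviation src :: "'a set \<Rightarrow> 'a set" where "src \<equiv> coset_source N Z"
abbreviation rng :: "'a set \<Rightarrow> 'a set" where "rng \<equiv> coset_range N Z"

lemma composable_if_src_eq_rng:
  assumes B: "B \<in> cosets N Z" and C: "C \<in> cosets N Z" and eq: "src B = rng C"
  shows "composable B C"
  unfolding composable_def
proof (intro conjI B C)
  have eq: "(B\<^sup>\<star> * B)\<^sup>\<up> = (C * C\<^sup>\<star>)\<^sup>\<up>"
    using eq by (simp add: coset_source_def coset_range_def)
  note pB = cosets_inverse_pair[OF B] and pC = cosets_inverse_pair[OF C]
  note pB' = inverse_pair_unit[OF inverse_pair_sym[OF pB]] and pC' = inverse_pair_unit[OF pC]
  have "B * (C * C\<^sup>\<star>) \<subseteq> B\<^sup>\<up> * (B\<^sup>\<star> * B)\<^sup>\<up>"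
    unfolding eq by (intro set_times_mono2 inverse_pair_up[OF pB] inverse_pair_up[OF pC'])
  also have "\<dots> \<subseteq> (B * (B\<^sup>\<star> * B))\<^sup>\<up>"
    by (rule inverse_pair_up_mult[OF pB pB'])
  also have "\<dots> \<subseteq> B\<^sup>\<up>"
    using pB by (intro up_mono) (simp add: inverse_pair_def mult.assoc)
  finally show "B * C * C\<^sup>\<star> \<subseteq> B"
    by (simp add: mult.assoc cosets_up[OF B])
  have "B\<^sup>\<star> * B * C \<subseteq> (C * C\<^sup>\<star>)\<^sup>\<up> * C\<^sup>\<up>"
    unfolding eq[symmetric] by (intro set_times_mono2 inverse_pair_up[OF pC] inverse_pair_up[OF pB'])
  also have "\<dots> \<subseteq> (C * C\<^sup>\<star> * C)\<^sup>\<up>"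
    by (rule inverse_pair_up_mult[OF pC' pC])
  also have "\<dots> \<subseteq> C\<^sup>\<up>"
    using pC by (intro up_mono) (simp add: inverse_pair_def mult.assoc)
  finally show "B\<^sup>\<star> * B * C \<subseteq> C"
    by (simp add: cosets_up[OF C])
qed

lemma cosets_up_triple:
  assumes C: "C \<in> cosets N Z"
  shows "(C * C\<^sup>\<star> * C)\<^sup>\<up> = C"
proof
  show "(C * C\<^sup>\<star> * C)\<^sup>\<up> \<subseteq> C"
    using up_mono[of "C * C\<^sup>\<star> * C" C] cosets_inverse_pair[OF C] cosets_up[OF C]
    by (simp add: inverse_pair_def)
  show "C \<subseteq> (C * C\<^sup>\<star> * C)\<^sup>\<up>"
  proof
    fix c assume "c \<in> C"
    then obtain b t where b: "b \<in> C" "b \<prec>\<^bsub>t\<^esub> c"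
      using cosets_up[OF C] by (metis mem_upE)
    obtain a s where a: "a \<in> C" "a \<prec>\<^bsub>s\<^esub> b"
      using b(1) cosets_up[OF C] by (metis mem_upE)
    have "a * s * b \<in> C * C\<^sup>\<star> * C"
      using a b mem_starI by (intro set_times_intro) auto
    then show "c \<in> (C * C\<^sup>\<star> * C)\<^sup>\<up>"
      using mem_upI[OF _ dom_via_trans[OF a(2) b(2)]] dom_viaD(1)[OF a(2)]
      by (simp add: mult.assoc)
  qed
qed

lemma rng_eq_src_star: "C \<in> cosets N Z \<Longrightarrow> rng C = src (C\<^sup>\<star>)"
  by (simp add: coset_source_def coset_range_def star_star)

lemma src_in_cosets: "C \<in> cosets N Z \<Longrightarrow> src C \<in> cosets N Z"
  using composable_mult(1)[OF composable_star_left] by (simp add: coset_source_def)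

lemma star_src: "C \<in> cosets N Z \<Longrightarrow> (src C)\<^sup>\<star> = src C"
  using composable_mult(2)[OF composable_star_left] star_star by (simp add: coset_source_def)

lemma src_mult_closed:
  assumes C: "C \<in> cosets N Z"
  shows "src C * src C \<subseteq> src C"
proof -
  note pC = cosets_inverse_pair[OF C]
  note p = inverse_pair_unit[OF inverse_pair_sym[OF pC]]
  have "src C * src C \<subseteq> ((C\<^sup>\<star> * C) * (C\<^sup>\<star> * C))\<^sup>\<up>"
    unfolding coset_source_def by (rule inverse_pair_up_mult[OF p p])
  also have "(C\<^sup>\<star> * C) * (C\<^sup>\<star> * C) = C\<^sup>\<star> * (C * C\<^sup>\<star> * C)"
    by (simp add: mult.assoc)
  also have "(C\<^sup>\<star> * (C * C\<^sup>\<star> * C))\<^sup>\<up> \<subseteq> (C\<^sup>\<star> * C)\<^sup>\<up>"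
    using pC by (intro up_mono set_times_mono2 order_refl) (simp add: inverse_pair_def)
  finally show ?thesis
    by (simp add: coset_source_def)
qed

lemma src_src_rng_src:
  assumes C: "C \<in> cosets N Z"
  shows "src (src C) = src C" "rng (src C) = src C"
proof -
  let ?U = "src C"
  note U = src_in_cosets[OF C] and UU = src_mult_closed[OF C]
  have "(?U * ?U * ?U)\<^sup>\<up> = ?U"
    using cosets_up_triple[OF U] star_src[OF C] by simp
  moreover have "(?U * ?U * ?U)\<^sup>\<up> \<subseteq> (?U * ?U)\<^sup>\<up>"
    by (intro up_mono set_times_mono2 UU order_refl)
  moreover have "(?U * ?U)\<^sup>\<up> \<subseteq> ?U"
    using up_mono[OF UU] cosets_up[OF U] by simp
  ultimately have "(?U * ?U)\<^sup>\<up> = ?U" by simp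
  then show "src ?U = ?U" "rng ?U = ?U"
    using star_src[OF C] by (simp_all add: coset_source_def[of _ _ ?U] coset_range_def)
qed

text \<open>In groupoid terms, \<open>(B C)\<^sup>\<star> (B C) = C\<^sup>\<star> (B\<^sup>\<star> B) C\<close> and \<open>B\<^sup>\<star> B\<close> acts on \<open>C\<close> as \<open>r(C)\<close>. Before
  closing upwards only \<open>B\<^sup>\<star> B C \<subseteq> C\<close> is available, hence the detour through \<open>(B\<^sup>\<star> B C)\<^sup>\<up> = C\<close>.\<close>

lemma src_coset_mult:
  assumes B: "B \<in> cosets N Z" and C: "C \<in> cosets N Z" and eq: "src B = rng C"
  shows "src ((B * C)\<^sup>\<up>) = src C"
proof -
  note BC = composable_if_src_eq_rng[OF assms]
  note p = composable_inverse_pair[OF BC] 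
  note pB = cosets_inverse_pair[OF B] and pC = cosets_inverse_pair[OF C]
  note pB' = inverse_pair_unit[OF inverse_pair_sym[OF pB]] and pC' = inverse_pair_unit[OF pC]
  have "(B\<^sup>\<star> * B * C)\<^sup>\<up> = ((B\<^sup>\<star> * B)\<^sup>\<up> * C\<^sup>\<up>)\<^sup>\<up>"
    by (rule inverse_pair_up_up_mult[OF pB' pC, symmetric])
  also have "(B\<^sup>\<star> * B)\<^sup>\<up> = (C * C\<^sup>\<star>)\<^sup>\<up>"
    using eq by (simp add: coset_source_def coset_range_def)
  also have "((C * C\<^sup>\<star>)\<^sup>\<up> * C\<^sup>\<up>)\<^sup>\<up> = (C * C\<^sup>\<star> * C)\<^sup>\<up>"
    by (rule inverse_pair_up_up_mult[OF pC' pC])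
  finally have C_eq: "(B\<^sup>\<star> * B * C)\<^sup>\<up> = C"
    by (simp add: cosets_up_triple[OF C])
  have p3: "inverse_pair (B\<^sup>\<star> * B * C) (C\<^sup>\<star> * (B\<^sup>\<star> * B))"
  proof (rule inverse_pair_mult[OF pB' pC])
    have 1: "B * C * C\<^sup>\<star> \<subseteq> B" "B\<^sup>\<star> * B * C \<subseteq> C"
      using BC by (auto simp: composable_def)
    show "B\<^sup>\<star> * B * C * C\<^sup>\<star> \<subseteq> B\<^sup>\<star> * B"
      using set_times_mono2[OF order_refl 1(1), of "B\<^sup>\<star>"] by (simp add: mult.assoc)
    show "B\<^sup>\<star> * B * (B\<^sup>\<star> * B) * C \<subseteq> C"
      using set_times_mono2[OF order_refl 1(2), of "B\<^sup>\<star> * B"] 1(2) by (simp add: mult.assoc)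
  qed
  have "src ((B * C)\<^sup>\<up>) = ((C\<^sup>\<star> * B\<^sup>\<star>)\<^sup>\<up> * (B * C)\<^sup>\<up>)\<^sup>\<up>"
    by (simp add: coset_source_def composable_mult(2)[OF BC])
  also have "\<dots> = ((C\<^sup>\<star> * B\<^sup>\<star>) * (B * C))\<^sup>\<up>"
    by (rule inverse_pair_up_up_mult[OF inverse_pair_sym[OF p] p])
  also have "\<dots> = (C\<^sup>\<star> * (B\<^sup>\<star> * B * C))\<^sup>\<up>"
    by (simp add: mult.assoc)
  also have "\<dots> = ((C\<^sup>\<star>)\<^sup>\<up> * (B\<^sup>\<star> * B * C)\<^sup>\<up>)\<^sup>\<up>"
    by (rule inverse_pair_up_up_mult[OF inverse_pair_sym[OF pC] p3, symmetric])
  also have "\<dots> = src C"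
    by (simp add: C_eq cosets_up[OF star_in_cosets[OF C]] coset_source_def)
  finally show ?thesis .
qed

lemma rng_coset_mult:
  assumes B: "B \<in> cosets N Z" and C: "C \<in> cosets N Z" and eq: "src B = rng C"
  shows "rng ((B * C)\<^sup>\<up>) = rng B"
proof -
  note BC = composable_if_src_eq_rng[OF assms]
  have "rng ((B * C)\<^sup>\<up>) = src ((C\<^sup>\<star> * B\<^sup>\<star>)\<^sup>\<up>)"
    by (simp add: rng_eq_src_star composable_mult[OF BC])
  also have "\<dots> = src (B\<^sup>\<star>)"
    using eq by (intro src_coset_mult) (simp_all add: star_in_cosets B C rng_eq_src_star star_star)
  finally show ?thesis
    by (simp add: rng_eq_src_star B)
qed

lemma coset_groupoid:
  "groupoid (cosets N Z) src rng (star N Z) (coset_mult N Z)"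
proof
  fix g assume g: "g \<in> cosets N Z"
  note p = cosets_inverse_pair[OF g] and g' = star_in_cosets[OF g]
  note ps = inverse_pair_unit[OF inverse_pair_sym[OF p]] and pr = inverse_pair_unit[OF p]
  show "src g \<in> cosets N Z" "rng g \<in> cosets N Z"
    by (simp_all add: src_in_cosets g rng_eq_src_star star_in_cosets)
  show "src (src g) = src g" "rng (src g) = src g"
    by (rule src_src_rng_src[OF g])+
  show "src (rng g) = rng g" "rng (rng g) = rng g"
    using src_src_rng_src[OF g'] by (simp_all add: rng_eq_src_star[OF g])
  show "g\<^sup>\<star> \<in> cosets N Z" by (rule g')
  show "src (g\<^sup>\<star>) = rng g" "rng (g\<^sup>\<star>) = src g"
    by (simp_all add: coset_source_def coset_range_def star_star[OF g])
  show "coset_mult N Z (g\<^sup>\<star>) g = src g" "coset_mult N Z g (g\<^sup>\<star>) = rng g"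
    by (simp_all add: coset_source_def coset_range_def coset_mult_def)
  have "(g\<^sup>\<up> * (g\<^sup>\<star> * g)\<^sup>\<up>)\<^sup>\<up> = g"
    unfolding inverse_pair_up_up_mult[OF p ps] using cosets_up_triple[OF g]
    by (simp add: mult.assoc)
  then show "coset_mult N Z g (src g) = g"
    by (simp add: coset_mult_def coset_source_def cosets_up[OF g])
  have "((g * g\<^sup>\<star>)\<^sup>\<up> * g\<^sup>\<up>)\<^sup>\<up> = g"
    unfolding inverse_pair_up_up_mult[OF pr p] by (rule cosets_up_triple[OF g])
  then show "coset_mult N Z (rng g) g = g"
    by (simp add: coset_mult_def coset_range_def cosets_up[OF g])
next
  fix g h assume gh: "g \<in> cosets N Z" "h \<in> cosets N Z" "src g = rng h"
  show "coset_mult N Z g h \<in> cosets N Z"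
    unfolding coset_mult_def by (rule composable_mult(1)[OF composable_if_src_eq_rng[OF gh]])
  show "src (coset_mult N Z g h) = src h" "rng (coset_mult N Z g h) = rng g"
    unfolding coset_mult_def by (rule src_coset_mult[OF gh], rule rng_coset_mult[OF gh])
next
  fix f g h assume f: "f \<in> cosets N Z" and g: "g \<in> cosets N Z" and h: "h \<in> cosets N Z"
    and fg: "src f = rng g" and gh: "src g = rng h"
  note pfg = composable_inverse_pair[OF composable_if_src_eq_rng[OF f g fg]]
  note pgh = composable_inverse_pair[OF composable_if_src_eq_rng[OF g h gh]]
  show "coset_mult N Z (coset_mult N Z f g) h = coset_mult N Z f (coset_mult N Z g h)"
    using inverse_pair_up_up_mult[OF pfg cosets_inverse_pair[OF h]]
      inverse_pair_up_up_mult[OF cosets_inverse_pair[OF f] pgh]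
    by (simp add: coset_mult_def cosets_up[OF f] cosets_up[OF h] mult.assoc)
qed

section \<open>The canonical topology\<close>

lemma openin_basic: "openin (canonical_topology N Z) {C \<in> cosets N Z. a \<in> C}"
  unfolding canonical_topology_def by (rule topology_generated_by_Basis) simp

lemma topspace_canonical: "topspace (canonical_topology N Z) = cosets N Z"
  by (auto simp: canonical_topology_def cosets_def)

lemma openin_canonical_iff:
  "openin (canonical_topology N Z) W \<longleftrightarrow> W \<subseteq> cosets N Z \<and>
     (\<forall>C\<in>W. \<exists>F. finite F \<and> F \<subseteq> C \<and> (\<forall>D\<in>cosets N Z. F \<subseteq> D \<longrightarrow> D \<in> W))"
  (is "openin ?T W \<longleftrightarrow> ?R W")
proof
  assume "openin ?T W"
  then have "generate_topology_on (range (\<lambda>a. {C \<in> cosets N Z. a \<in> C})) W"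
    by (simp add: canonical_topology_def openin_topology_generated_by_iff)
  then show "?R W"
  proof induction
    case (Int A B)
    have "\<exists>F. finite F \<and> F \<subseteq> C \<and> (\<forall>D\<in>cosets N Z. F \<subseteq> D \<longrightarrow> D \<in> A \<inter> B)" if "C \<in> A \<inter> B" for C
    proof -
      have C: "C \<in> A" "C \<in> B" using that by auto
      obtain F where "finite F" "F \<subseteq> C" "\<forall>D\<in>cosets N Z. F \<subseteq> D \<longrightarrow> D \<in> A"
        using Int.IH(1) C(1) by meson
      moreover obtain G where "finite G" "G \<subseteq> C" "\<forall>D\<in>cosets N Z. G \<subseteq> D \<longrightarrow> D \<in> B"
        using Int.IH(2) C(2) by meson
      ultimately show ?thesis by (intro exI[of _ "F \<union> G"]) auto
    qed
    then show ?case using Int.IH by (simp add: le_infI1)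
  next
    case (UN K)
    then show ?case by (meson UnionE UnionI Union_least)
  next
    case (Basis A)
    then obtain a where A: "A = {C \<in> cosets N Z. a \<in> C}" by blast
    show ?case
      unfolding A by (intro conjI ballI exI[of _ "{a}"]) auto
  qed simp
next
  assume R: "?R W"
  have basic: "openin ?T {D \<in> cosets N Z. F \<subseteq> D}" if "finite F" for F
    using that
  proof (induction F)
    case empty
    then show ?case
      by (simp add: openin_topspace flip: topspace_canonical)
  next
    case (insert a F)
    have "openin ?T ({D \<in> cosets N Z. a \<in> D} \<inter> {D \<in> cosets N Z. F \<subseteq> D})"
      by (rule openin_Int[OF openin_basic insert.IH])
    then show ?case
      by (rule back_subst[where P = "openin ?T"]) auto
  qed
  show "openin ?T W"
    unfolding openin_subopen[of _ W]
  proof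
    fix C assume C: "C \<in> W"
    then obtain F where "finite F" "F \<subseteq> C" "\<forall>D\<in>cosets N Z. F \<subseteq> D \<longrightarrow> D \<in> W"
      using R by meson
    then show "\<exists>U. openin ?T U \<and> C \<in> U \<and> U \<subseteq> W"
      using R C basic by (intro exI[of _ "{D \<in> cosets N Z. F \<subseteq> D}"]) auto
  qed
qed

lemma continuous_map_canonicalI:
  assumes "\<And>x. x \<in> topspace X \<Longrightarrow> f x \<in> cosets N Z"
    and "\<And>a. openin X {x \<in> topspace X. a \<in> f x}"
  shows "continuous_map X (canonical_topology N Z) f"
  unfolding canonical_topology_def
proof (rule continuous_on_generated_topo)
  fix U assume "U \<in> range (\<lambda>a. {C \<in> cosets N Z. a \<in> C})"
  then obtain a where U: "U = {C \<in> cosets N Z. a \<in> C}" by blast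
  have "f -` U \<inter> topspace X = {x \<in> topspace X. a \<in> f x}"
    using assms(1) U by auto
  then show "openin X (f -` U \<inter> topspace X)"
    using assms(2) by simp
next
  show "f ` topspace X \<subseteq> \<Union> (range (\<lambda>a. {C \<in> cosets N Z. a \<in> C}))"
    using assms(1) by (auto simp: cosets_def) blast
qed

lemma continuous_star:
  "continuous_map (canonical_topology N Z) (canonical_topology N Z) (star N Z)"
proof (rule continuous_map_canonicalI)
  fix s
  have "{C \<in> cosets N Z. s \<in> C\<^sup>\<star>} = (\<Union>a\<in>{a. \<exists>b. a \<prec>\<^bsub>s\<^esub> b}. {C \<in> cosets N Z. a \<in> C})"
    by (auto simp: mem_star_iff)
  then show "openin (canonical_topology N Z) {C \<in> topspace (canonical_topology N Z). s \<in> C\<^sup>\<star>}"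
    unfolding topspace_canonical using openin_basic by auto
qed (simp add: topspace_canonical star_in_cosets)

text \<open>That \<open>a\<close> lies in \<open>B \<cdot> C\<close> is witnessed by one \<open>b \<in> B\<close> and one \<open>c \<in> C\<close> with \<open>b c\<close> below \<open>a\<close>, so the preimage
  of a subbasic set is a union of boxes.\<close>

lemma continuous_coset_mult:
  fixes T defines "T \<equiv> canonical_topology N Z"
  shows "continuous_map (subtopology (prod_topology T T)
           {(B, C) \<in> cosets N Z \<times> cosets N Z. src B = rng C}) T (\<lambda>(B, C). coset_mult N Z B C)"
    (is "continuous_map (subtopology _ ?E) _ _")
  unfolding T_def
proof (rule continuous_map_canonicalI)
  let ?T = "canonical_topology N Z"
  let ?X = "subtopology (prod_topology ?T ?T) ?E"
  have X: "topspace ?X = ?E"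
    by (auto simp: topspace_canonical)
  show "(case x of (B, C) \<Rightarrow> coset_mult N Z B C) \<in> cosets N Z" if "x \<in> topspace ?X" for x
    using that composable_mult(1)[OF composable_if_src_eq_rng] unfolding X
    by (auto simp: coset_mult_def)
  fix a
  let ?V = "\<Union>b. \<Union>c\<in>{c. dominated N Z (b * c) a}.
               {B \<in> cosets N Z. b \<in> B} \<times> {C \<in> cosets N Z. c \<in> C}"
  have box: "openin (prod_topology ?T ?T) ({B \<in> cosets N Z. b \<in> B} \<times> {C \<in> cosets N Z. c \<in> C})"
    for b c by (simp add: openin_prod_Times_iff openin_basic)
  have "openin (prod_topology ?T ?T) ?V"
    by (rule openin_Union, elim imageE, hypsubst, rule openin_Union, elim imageE, hypsubst, rule box)
  moreover have "{x \<in> topspace ?X. a \<in> (case x of (B, C) \<Rightarrow> coset_mult N Z B C)} = ?V \<inter> ?E"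
    unfolding X
  proof (rule set_eqI, clarify)
    fix B C
    have mult: "a \<in> coset_mult N Z B C \<longleftrightarrow> (\<exists>b\<in>B. \<exists>c\<in>C. dominated N Z (b * c) a)"
      unfolding coset_mult_def up_def set_times_def by blast
    show "(B, C) \<in> {x \<in> ?E. a \<in> (case x of (B, C) \<Rightarrow> coset_mult N Z B C)} \<longleftrightarrow> (B, C) \<in> ?V \<inter> ?E"
      by (simp add: mult) blast
  qed
  ultimately show "openin ?X {x \<in> topspace ?X. a \<in> (case x of (B, C) \<Rightarrow> coset_mult N Z B C)}"
    by (auto simp: openin_subtopology)
qed

section \<open>Openness of the source map\<close>

text \<open>The element \<open>z\<close> puts \<open>D\<close> and \<open>D\<^sup>\<star>\<close> in contact: \<open>n\<close> is dominated by \<open>z\<close> via \<open>z\<close>, so \<open>z \<in> D\<^sup>\<star>\<close>, and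
  \<open>n = n z = z n\<close> then allows multiplication by \<open>n\<close> on either side inside \<open>D\<close>. Inserting \<open>n\<close> corrects the parity of a
  word, which is how elements of \<open>D\<^sup>\<star>\<close> and of \<open>D D\<close> get lower bounds in \<open>D\<close>.\<close>

lemma coset_unitI:
  assumes D: "coset N Z D" and n: "n \<in> D" "n \<in> N" and z: "z \<in> Z" "z * n = n"
  shows "D\<^sup>\<star> = D" "D * D \<subseteq> D"
proof -
  have nz: "n * z = n"
    using N_Z_commute[OF n(2) z(1)] z(2) by simp
  have "n \<prec>\<^bsub>z\<^esub> z"
    by (rule dom_viaI) (simp_all add: nz n z Z_mult flip: mult.assoc)
  then have zD: "z \<in> D\<^sup>\<star>"
    using mem_starI[OF n(1)] by blast
  have left: "n * x \<in> D" if "x \<in> D" for x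
    using coset_mult3[OF D n(1) zD that] by (simp add: nz)
  have right: "x * n \<in> D" if "x \<in> D" for x
    using coset_mult3[OF D that zD n(1)] by (simp add: z(2) mult.assoc)
  have sub: "D\<^sup>\<star> \<subseteq> D"
  proof
    fix s assume "s \<in> D\<^sup>\<star>"
    then obtain t a where t: "t \<in> D\<^sup>\<star>" "t \<prec>\<^bsub>a\<^esub> s"
      using coset_up[OF coset_star[OF D]] by (metis mem_upE)
    then have a: "a \<in> D"
      using coset_star_star[OF D] mem_starI by blast
    let ?y = "n * (t * a * t)"
    have "?y * a * ?y * n \<prec>\<^bsub>a\<^esub> s"
      by (intro dom_via_shrink_right dom_via_shrink_left t n)
    moreover have "(((n * t * a) * t * (a * n)) * t * a) * t * n \<in> D"
      by (intro coset_mult3[OF D] right t a n)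
    ultimately show "s \<in> D"
      using coset_memI[OF D] by (simp add: mult.assoc)
  qed
  then show "D\<^sup>\<star> = D"
    using star_mono[OF sub] coset_star_star[OF D] by auto
  show "D * D \<subseteq> D"
  proof (clarify elim!: set_times_elim)
    fix d e assume de: "d \<in> D" "e \<in> D"
    obtain a s where a: "a \<in> D" "a \<prec>\<^bsub>s\<^esub> d"
      using de(1) coset_up[OF D] by (metis mem_upE)
    obtain c t where c: "c \<in> D" "c \<prec>\<^bsub>t\<^esub> e"
      using de(2) coset_up[OF D] by (metis mem_upE)
    note [simp] = dom_viaD[OF a(2)] dom_viaD[OF c(2)]
    let ?n = "(s * a) * n * (c * t)"
    have nN: "?n \<in> N"
      by (rule N_mult[OF N_mult[OF _ n(2)]]) simp_all
    have "s * d * (s * a) = s * a"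
      using N_Z_commute[of "s * a" "s * d"] by (simp add: mult.assoc)
    then have 1: "(s * d) * ?n = ?n"
      by (metis mult.assoc)
    have 2: "(e * t) * ?n = ?n"
      using N_Z_commute[OF nN, of "e * t"] by (simp add: mult.assoc)
    have "a * ?n * c \<prec>\<^bsub>t * s\<^esub> d * e"
      by (rule dom_via_mult[OF a(2) c(2) nN 1 2])
    moreover have "(a * s * a) * z * (n * (c * t * c)) \<in> D"
      by (intro coset_mult3[OF D] left zD mem_starI[OF a] mem_starI[OF c] a(1) c(1))
    moreover have "z * (n * x) = n * x" for x
      using z(2) by (metis mult.assoc)
    ultimately have "a * ?n * c \<prec>\<^bsub>t * s\<^esub> d * e" "a * ?n * c \<in> D"
      by (simp_all add: mult.assoc)
    then show "d * e \<in> D"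
      using coset_memI[OF D] by blast
  qed
qed

text \<open>For a unit \<open>D\<close> the pair \<open>(b D, D r)\<close> is an inverse pair, and \<open>D\<close> absorbs \<open>D r b D\<close>. The two
  elements \<open>r a\<close> and \<open>r b\<close> of \<open>D\<close> say that \<open>r\<close> inverts \<open>b\<close> over the unit \<open>D\<close>.\<close>

lemma unit_translate:
  assumes D: "D \<in> cosets N Z" and unit: "D\<^sup>\<star> = D" "D * D \<subseteq> D"
    and b: "a \<prec>\<^bsub>r\<^esub> b" "r * a \<in> D" "r * b \<in> D"
  shows "({b} * D)\<^sup>\<up> \<in> cosets N Z" "src (({b} * D)\<^sup>\<up>) = D"
proof -
  have DD: "x * y \<in> D" if "x \<in> D" "y \<in> D" for x y
    using unit(2) that by (meson set_times_intro subsetD)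
  note [simp] = dom_viaD[OF b(1)]
  have memP: "b * x \<in> {b} * D" and memQ: "x * r \<in> D * {r}" if "x \<in> D" for x
    using that by (simp_all add: set_times_intro)
  have below: "\<exists>d' e. d' \<in> D \<and> d' \<prec>\<^bsub>d\<^esub> e" if "d \<in> D" for d
    using that unit(1) by (metis mem_starE)
  have "{b} * D \<subseteq> (D * {r})\<^sup>\<star>"
  proof (clarify elim!: set_times_elim)
    fix d assume d: "d \<in> D"
    obtain d' e where d': "d' \<in> D" "d' \<prec>\<^bsub>d\<^esub> e" using below[OF d] by blast
    have "(d' * d * d') * ((r * a * r) * b * (r * a * r)) \<prec>\<^bsub>b * d\<^esub> e * r"
      using dom_viaD[OF d'(2)]
      by (intro dom_via_mult_shrunk d' dom_via_flip[OF b(1)]) (simp_all add: mult.assoc)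
    moreover have "(d' * d * d') * ((r * a) * (r * b) * (r * a)) * r \<in> D * {r}"
      by (intro memQ DD d d' b)
    then have "(d' * d * d') * ((r * a * r) * b * (r * a * r)) \<in> D * {r}"
      by (simp add: mult.assoc)
    ultimately show "b * d \<in> (D * {r})\<^sup>\<star>"
      by (rule mem_starI[rotated])
  qed
  moreover have "D * {r} \<subseteq> ({b} * D)\<^sup>\<star>"
  proof (clarify elim!: set_times_elim)
    fix d assume d: "d \<in> D"
    obtain d' e where d': "d' \<in> D" "d' \<prec>\<^bsub>d\<^esub> e" using below[OF d] by blast
    have "(a * r * a) * (d' * d * d') \<prec>\<^bsub>d * r\<^esub> b * e"
      using dom_viaD[OF d'(2)] by (intro dom_via_mult_shrunk d' b(1)) simp_all
    moreover have "b * ((r * a) * (r * a) * (d' * d * d')) \<in> {b} * D"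
      by (intro memP DD d d' b)
    then have "(a * r * a) * (d' * d * d') \<in> {b} * D"
      by (simp add: mult.assoc)
    ultimately show "d * r \<in> ({b} * D)\<^sup>\<star>"
      by (rule mem_starI[rotated])
  qed
  moreover have "{b} * D * (D * {r}) * ({b} * D) \<subseteq> {b} * D"
  proof (clarify elim!: set_times_elim)
    fix x y z assume "x \<in> D" "y \<in> D" "z \<in> D"
    then have "b * (x * y * (r * b) * z) \<in> {b} * D"
      by (intro memP DD b)
    then show "b * x * (y * r) * (b * z) \<in> {b} * D"
      by (simp add: mult.assoc)
  qed
  moreover have rbD: "D * {r} * ({b} * D) \<subseteq> D"
  proof (clarify elim!: set_times_elim)
    fix x y assume "x \<in> D" "y \<in> D"
    then have "x * (r * b) * y \<in> D"
      by (intro DD b)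
    then show "x * r * (b * y) \<in> D"
      by (simp add: mult.assoc)
  qed
  moreover have "D * {r} * ({b} * D) * (D * {r}) \<subseteq> D * {r}"
    using set_times_mono2[OF order_trans[OF set_times_mono2[OF rbD order_refl] unit(2)] order_refl, of "{r}"]
    by (simp add: mult.assoc)
  ultimately have p: "inverse_pair ({b} * D) (D * {r})"
    by (simp add: inverse_pair_def)
  have star: "({b} * D)\<^sup>\<star> \<subseteq> (D * {r})\<^sup>\<up>"
  proof (rule star_subset_of_acting_coset[OF cosetsD[OF D] p])
    show "D * {r} * ({b} * D) * D\<^sup>\<star> \<subseteq> D\<^sup>\<star>"
      unfolding unit(1) using order_trans[OF set_times_mono2[OF rbD order_refl] unit(2)] .
    show "D\<^sup>\<star> * D * (D * {r}) \<subseteq> D * {r}"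
      unfolding unit(1)
      using set_times_mono2[OF order_trans[OF set_times_mono2[OF unit(2) order_refl] unit(2)] order_refl, of "{r}"]
      by (simp add: mult.assoc)
  qed
  show "({b} * D)\<^sup>\<up> \<in> cosets N Z"
    using inverse_pair_saturate(1)[OF p star] inverse_pair_up[OF p] memP b(2) 
    by (auto simp: cosets_def)
  have "src (({b} * D)\<^sup>\<up>) = (D * {r} * ({b} * D))\<^sup>\<up>"
    by (simp add: coset_source_def inverse_pair_saturate(2)[OF p star] 
          inverse_pair_up_up_mult[OF inverse_pair_sym[OF p] p])
  also have "\<dots> = D"
  proof
    show "(D * {r} * ({b} * D))\<^sup>\<up> \<subseteq> D"
      using up_mono[OF rbD] cosets_up[OF D] by simp
    show "D \<subseteq> (D * {r} * ({b} * D))\<^sup>\<up>"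
    proof
      fix d assume "d \<in> D"
      then obtain c t where c: "c \<in> D" "c \<prec>\<^bsub>t\<^esub> d"
        using cosets_up[OF D] by (metis mem_upE)
      have "t \<in> D"
        using mem_starI[OF c] unit by simp
      then have "((r * a) * r) * (b * (c * t * c)) \<in> D * {r} * ({b} * D)"
        by (intro set_times_intro[OF memQ memP] DD c b)
      then have "(r * a) * (c * t * c) \<in> D * {r} * ({b} * D)"
        by (simp add: mult.assoc)
      moreover have "(r * a) * (c * t * c) \<prec>\<^bsub>t\<^esub> d"
        by (rule dom_via_shrink_left[OF c(2)]) simp
      ultimately show "d \<in> (D * {r} * ({b} * D))\<^sup>\<up>"
        by (rule mem_upI)
    qed
  qed
  finally show "src (({b} * D)\<^sup>\<up>) = D" .
qed

text \<open>Let \<open>C \<in> W\<close>, where membership in \<open>W\<close> follows from containing a finite set \<open>F \<subseteq> C\<close>, and let \<open>r\<close> invert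
  \<open>b' \<in> C\<close>. Any coset \<open>D\<close> that contains \<open>r b'\<close> is a unit by \<open>coset_unitI\<close> with \<open>z = r b\<close>. If it also contains
  \<open>r (c t c)\<close> with \<open>c \<in> C\<close> and \<open>t\<close> inverting \<open>a\<close> on \<open>c\<close>, then \<open>b D\<close> contains \<open>b' r (c t c)\<close>, which lies below \<open>a\<close>. Finitely many
  conditions on \<open>D\<close> thus put \<open>F\<close> into a coset with source \<open>D\<close>.\<close>

lemma open_map_src: "open_map (canonical_topology N Z) (canonical_topology N Z) src"
  unfolding open_map_def
proof (intro allI impI)
  fix W assume W: "openin (canonical_topology N Z) W"
  have "\<exists>G. finite G \<and> G \<subseteq> src C \<and> (\<forall>D\<in>cosets N Z. G \<subseteq> D \<longrightarrow> D \<in> src ` W)" if CW: "C \<in> W" for C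
  proof -
    obtain F where F: "finite F" "F \<subseteq> C" "\<And>D. D \<in> cosets N Z \<Longrightarrow> F \<subseteq> D \<Longrightarrow> D \<in> W"
      using W CW unfolding openin_canonical_iff by meson
    have C: "C \<in> cosets N Z"
      using W CW unfolding openin_canonical_iff by blast
    obtain b where "b \<in> C"
      using cosetsD(2)[OF C] by blast
    then obtain b' r where b: "b' \<in> C" "b' \<prec>\<^bsub>r\<^esub> b"
      using cosets_up[OF C] by (metis mem_upE)
    have "\<forall>a\<in>F. \<exists>c t. c \<in> C \<and> c \<prec>\<^bsub>t\<^esub> a"
      using F(2) cosets_up[OF C] by (metis mem_upE subsetD)
    then obtain c t where c: "\<And>a. a \<in> F \<Longrightarrow> c a \<in> C" "\<And>a. a \<in> F \<Longrightarrow> c a \<prec>\<^bsub>t a\<^esub> a"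
      by metis
    let ?g = "\<lambda>a. r * (c a * t a * c a)"
    let ?G = "insert (r * b') (?g ` F)"
    have mem: "r * x \<in> src C" if "x \<in> C" for x
      using mem_starI[OF b] that 
        inverse_pair_up[OF inverse_pair_unit[OF inverse_pair_sym[OF cosets_inverse_pair[OF C]]]]
      unfolding coset_source_def by (meson set_times_intro subsetD)
    have "c a * t a * c a \<in> C" if "a \<in> F" for a
      using that by (intro coset_mult3[OF cosetsD(1)[OF C]] c mem_starI[OF c])
    then have "?G \<subseteq> src C"
      using mem b(1) by auto
    moreover have "D \<in> src ` W" if D: "D \<in> cosets N Z" "?G \<subseteq> D" for D
    proof -
      note [simp] = dom_viaD[OF b(2)]
      have rb': "r * b' \<in> D" using D(2) by simp
      have e: "r * b * (r * b') = r * b'" by (simp add: mult.assoc)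
      note unit = coset_unitI[OF cosetsD(1)[OF D(1)] rb' _ _ e]
      have "r * b' \<prec>\<^bsub>r * b\<^esub> r * b"
        using Z_mult[of "r * b" "r * b"] by (intro dom_viaI) (simp_all add: mult.assoc)
      then have rb: "r * b \<in> D"
        using coset_memI[OF cosetsD(1)[OF D(1)] rb'] by blast
      let ?C = "({b} * D)\<^sup>\<up>"
      have DD: "x * y \<in> D" if "x \<in> D" "y \<in> D" for x y
        using unit(2) that by simp (meson set_times_intro subsetD)
      have C': "?C \<in> cosets N Z" "src ?C = D"
        by (rule unit_translate[OF D(1) unit b(2) rb' rb]; simp)+
      have "F \<subseteq> ?C"
      proof
        fix a assume a: "a \<in> F"
        have "(b' * r) * (c a * t a * c a) \<prec>\<^bsub>t a\<^esub> a"
          by (rule dom_via_shrink_left[OF c(2)[OF a]]) simp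
        moreover have "b * ((r * b') * ?g a) \<in> {b} * D"
          using DD[OF rb', of "?g a"] D(2) a by (intro set_times_intro) auto
        then have "(b' * r) * (c a * t a * c a) \<in> {b} * D"
          by (simp add: mult.assoc)
        ultimately show "a \<in> ?C"
          by (rule mem_upI[rotated])
      qed
      then show ?thesis
        using F(3)[OF C'(1)] C'(2) by blast
    qed
    ultimately show ?thesis
      using F(1) by (intro exI[of _ ?G]) auto
  qed
  moreover have "src ` W \<subseteq> cosets N Z"
    using openin_subset[OF W] src_in_cosets unfolding topspace_canonical by blast
  ultimately show "openin (canonical_topology N Z) (src ` W)"
    unfolding openin_canonical_iff by simp
qed

lemma coset_groupoid_etale:
  "etale_groupoid (cosets N Z) src rng (star N Z) (coset_mult N Z) (canonical_topology N Z)"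
proof -
  interpret groupoid "cosets N Z" src rng "star N Z" "coset_mult N Z"
    by (rule coset_groupoid)
  show ?thesis
    by unfold_locales
      (rule topspace_canonical continuous_star continuous_coset_mult open_map_src)+
qed

end

theorem theorem7p4:
  fixes N Z :: "'a::semigroup_mult set"
  assumes "structured_semigroup N Z"
  shows "etale_groupoid (cosets N Z) (coset_source N Z) (coset_range N Z) (star N Z)
           (coset_mult N Z) (canonical_topology N Z)"
  by (rule structured.coset_groupoid_etale[OF structured.intro[OF assms]])

end
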